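(* Let $1<p<\infty$ and let $(P_t)_{t\ge0}$ be the Gaussian semigroup on $\mathbb{R}^d$. For every $f\in L^p(\mathbb{R}^d)$, $$\int_{\mathbb{R}^d}|f(x)|^p\,dx=p(p-1)\int_0^\infty\int_{\mathbb{R}^d}|P_tf(x)|^{p-2}\,|\nabla P_tf(x)|^2\,dx\,dt.$$
   Context: Here $d\ge1$, and $P_tf(x):=\int_{\mathbb{R}^d}f(y)p_t(x-y)\,dy$ for $t>0$, $x\in\mathbb{R}^d$, with $p_t(x)=(4\pi t)^{-d/2}e^{-|x|^2/(4t)}$ (Brownian motion running at twice the usual speed). For $t>0$, $P_tf$ is smooth in $x$ and $\nabla$ is the classical gradient in $x$. Functions are real-valued. Conventions: $0^0:=1$, $0^\kappa:=\infty$ for $\kappa<0$, and $0\cdot\infty:=0$. *)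

theory Defs
  imports "HOL-Analysis.Analysis"
begin

text \<open>
  Powers of a real \<open>x \<ge> 0\<close> with the conventions that zero to the power \<open>k\<close> is \<open>1\<close> for
  \<open>k = 0\<close> and \<open>\<infinity>\<close> for \<open>k < 0\<close>; HOL's \<^const>\<open>powr\<close> gives \<open>0\<close> in both cases.
  The convention \<open>0 * \<infinity> = 0\<close> is built into \<^typ>\<open>ennreal\<close>.
\<close>
definition epowr :: "real \<Rightarrow> real \<Rightarrow> ennreal" where
  "epowr x k =
     (if x = 0 then (if k < 0 then \<infinity> else if k = 0 then 1 else 0) else ennreal (x powr k))"

definition Lp :: "real \<Rightarrow> ('a::euclidean_space \<Rightarrow> real) set" where
  "Lp p = {f. f \<in> borel_measurable lebesgue \<and> integrable lebesgue (\<lambda>x. \<bar>f x\<bar> powr p)}"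

definition heat_kernel :: "real \<Rightarrow> 'a::euclidean_space \<Rightarrow> real" where
  "heat_kernel t x = (4 * pi * t) powr (- real DIM('a) / 2) * exp (- (norm x)\<^sup>2 / (4 * t))"

text \<open>Meaningful for \<open>t > 0\<close> only: the value at \<open>t = 0\<close> is not the identity.\<close>
definition gauss_semigroup :: "real \<Rightarrow> ('a::euclidean_space \<Rightarrow> real) \<Rightarrow> 'a \<Rightarrow> real" where
  "gauss_semigroup t f x = (LINT y|lebesgue. f y * heat_kernel t (x - y))"

definition gradient :: "('a::euclidean_space \<Rightarrow> real) \<Rightarrow> 'a \<Rightarrow> 'a" where
  "gradient u x = (THE D. GDERIV u x :> D)"

end

theory Submission
  imports Defs "HOL-Probability.Probability" "HOL-Real_Asymp.Real_Asymp"
begin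

text \<open>
  Let \<open>u\<close> be the heat flow started at \<open>f\<close>, so \<open>u t x\<close> is the value of the semigroup at time \<open>t\<close>. By the
  heat equation and one integration by parts,
  the time derivative of the integral of \<open>\<phi>(u t)\<close> is minus the integral of \<open>\<phi>''(u t) \<bar>\<nabla>u t\<bar>\<^sup>2\<close>.
  For \<open>\<phi> = \<bar>\<cdot>\<bar>\<^sup>p\<close> and integrated over all times this is the theorem, since the energy
  \<open>\<integral>\<bar>u t\<bar>\<^sup>p\<close> tends to \<open>\<integral>\<bar>f\<bar>\<^sup>p\<close> as \<open>t\<close> tends to \<open>0\<close> and to \<open>0\<close> as \<open>t\<close> tends to infinity.
  Three points need care.

  For \<open>p < 2\<close> the power is not twice differentiable at \<open>0\<close>. It is replaced by
  \<open>reg_powr\<close>, whose second derivative \<open>p (p - 1) (\<bar>u\<bar> + e)\<^bsup>p - 2\<^esup>\<close> increases as the shift \<open>e\<close> decreases to \<open>0\<close>,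
  at \<open>u = 0\<close> too. Monotone convergence then yields the integrand with exactly its convention at
  zeros of \<open>u\<close>, however large the zero set is.

  To have no boundary terms, the energy is localized by the cutoff \<open>(1 - \<bar>x\<bar>\<^sup>2 / R)\<^sub>+\<^sup>3\<close>, whose Laplacian
  is of order \<open>1 / R\<close>. Integration by parts for compactly supported functions is differentiation of
  a translation invariant integral (\<open>integral_directional_derivative_eq_0\<close>), and the
  result is \<open>localized_energy_identity\<close>. The derivatives of \<open>u\<close> come from
  differentiation under the integral, all derivatives of the kernel being dominated by Gaussians
  locally uniformly in time and space. Removing regularization and cutoff together
  gives \<open>energy_identity_interval\<close>, the identity on a compact interval of positive times.

  At the end points of time, Jensen's inequality shows that the energy never exceeds its initial
  value (\<open>heat_contraction\<close>). Approximation of \<open>f\<close> by continuous functions with compact support reduces the decay for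
  large times (\<open>heat_conv_decay\<close>) to a bound of \<open>u\<close> by a negative power of \<open>t\<close>, and the lower bound at
  time \<open>0\<close> (\<open>heat_conv_initial_lower\<close>) to pointwise convergence and Fatou's lemma.
\<close>

section \<open>Regularized powers\<close>

text \<open>
  Functions of \<open>\<bar>u\<bar>\<close> are differentiated away from \<open>u = 0\<close> by the chain rule. At \<open>u = 0\<close> the difference
  quotient on both sides is, up to a sign, the one-sided quotient at \<open>\<bar>u\<bar>\<close>; this lemma and the next
  one transfer the right derivative at \<open>0\<close> to an even and to an odd extension.
\<close>
lemma has_real_derivative_even_ext:
  fixes F :: "real \<Rightarrow> real"
  assumes "(F has_real_derivative 0) (at 0 within {0..})"
  shows "((\<lambda>u. F \<bar>u\<bar>) has_real_derivative 0) (at 0)"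
proof -
  have "((\<lambda>y. (F y - F 0) / (y - 0)) \<longlongrightarrow> 0) (at 0 within {0..})"
    using assms by (simp only: has_field_derivative_iff)
  moreover have "filterlim (\<lambda>u::real. \<bar>u\<bar>) (at 0 within {0..}) (at 0)"
    unfolding filterlim_at
    by (auto intro!: tendsto_eq_intros always_eventually simp: eventually_at_filter)
  ultimately have "((\<lambda>u. (F \<bar>u\<bar> - F 0) / (\<bar>u\<bar> - 0)) \<longlongrightarrow> 0) (at 0)"
    by (rule filterlim_compose)
  then have "((\<lambda>u. (F \<bar>u\<bar> - F \<bar>0\<bar>) / (u - 0)) \<longlongrightarrow> 0) (at 0)"
    by (subst (asm) tendsto_rabs_zero_iff[symmetric], subst tendsto_rabs_zero_iff[symmetric])
       (simp add: abs_divide)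
  then show ?thesis
    by (simp only: has_field_derivative_iff)
qed

lemma has_real_derivative_odd_ext:
  fixes F :: "real \<Rightarrow> real"
  assumes "(F has_real_derivative D) (at 0 within {0..})" and "F 0 = 0"
  shows "((\<lambda>u. sgn u * F \<bar>u\<bar>) has_real_derivative D) (at 0)"
proof -
  have "((\<lambda>y. (F y - F 0) / (y - 0)) \<longlongrightarrow> D) (at 0 within {0..})"
    using assms by (simp only: has_field_derivative_iff)
  moreover have "filterlim (\<lambda>u::real. \<bar>u\<bar>) (at 0 within {0..}) (at 0)"
    unfolding filterlim_at
    by (auto intro!: tendsto_eq_intros always_eventually simp: eventually_at_filter)
  ultimately have "((\<lambda>u. (F \<bar>u\<bar> - F 0) / (\<bar>u\<bar> - 0)) \<longlongrightarrow> D) (at 0)"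
    by (rule filterlim_compose)
  moreover have "(F \<bar>u\<bar> - F 0) / (\<bar>u\<bar> - 0) = (sgn u * F \<bar>u\<bar> - sgn 0 * F \<bar>0\<bar>) / (u - 0)" for u
    using assms(2) by (auto simp: sgn_if)
  ultimately show ?thesis
    by (simp only: has_field_derivative_iff)
qed

lemma shifted_powr_right_derivative:
  fixes e q :: real
  assumes "0 \<le> e" and "0 < e \<or> 1 < q"
  shows "((\<lambda>s. (s + e) powr q) has_real_derivative q * e powr (q - 1)) (at 0 within {0..})"
proof (cases "e = 0")
  case False
  then show ?thesis
    using assms by (auto intro!: derivative_eq_intros simp: powr_diff field_simps)
next
  case True
  then have q: "1 < q" using assms by auto
  have "((\<lambda>y. y powr (q - 1)) \<longlongrightarrow> 0) (at 0 within {0..})"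
    using q by (auto intro!: tendsto_eq_intros simp: eventually_at_filter)
  moreover have "\<forall>\<^sub>F y in at 0 within {0..}. y powr (q - 1) = (y powr q - 0 powr q) / (y - 0)"
    by (auto simp: eventually_at_filter powr_diff)
  ultimately have "((\<lambda>y. (y powr q - 0 powr q) / (y - 0)) \<longlongrightarrow> 0) (at 0 within {0..})"
    by (blast intro: Lim_transform_eventually)
  then show ?thesis
    by (simp add: has_field_derivative_iff True)
qed

text \<open>
  The shift by \<open>e\<close> inside the power removes the singularity of the second derivative at \<open>u = 0\<close>;
  the affine correction in \<open>\<bar>u\<bar>\<close> removes the kink that the shift creates. For \<open>e = 0\<close> this is the
  plain power \<open>\<bar>u\<bar> powr p\<close>.
\<close>
definition reg_powr :: "real \<Rightarrow> real \<Rightarrow> real \<Rightarrow> real" where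
  "reg_powr p e u = (\<bar>u\<bar> + e) powr p - e powr p - p * e powr (p - 1) * \<bar>u\<bar>"

definition reg_powr' :: "real \<Rightarrow> real \<Rightarrow> real \<Rightarrow> real" where
  "reg_powr' p e u = sgn u * (p * ((\<bar>u\<bar> + e) powr (p - 1) - e powr (p - 1)))"

definition reg_powr'' :: "real \<Rightarrow> real \<Rightarrow> real \<Rightarrow> real" where
  "reg_powr'' p e u = p * (p - 1) * (\<bar>u\<bar> + e) powr (p - 2)"

lemma reg_powr_zero [simp]: "reg_powr p e 0 = 0" "reg_powr' p e 0 = 0"
  by (simp_all add: reg_powr_def reg_powr'_def)

lemma reg_powr_eps0: "reg_powr p 0 u = \<bar>u\<bar> powr p"
  by (simp add: reg_powr_def)

lemma has_real_derivative_abs: "u \<noteq> 0 \<Longrightarrow> ((\<lambda>u::real. \<bar>u\<bar>) has_real_derivative sgn u) (at u)"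
proof -
  assume u: "u \<noteq> 0"
  have "((\<lambda>x. sgn u * x) has_real_derivative sgn u) (at u)"
    by (auto intro!: derivative_eq_intros)
  then show ?thesis
    by (rule has_field_derivative_transform_within_open[where S = "if 0 < u then {0<..} else {..<0}"])
      (use u in \<open>auto simp: sgn_if split: if_splits\<close>)
qed

lemma reg_powr_deriv:
  assumes "1 < p" "0 \<le> e"
  shows "(reg_powr p e has_real_derivative reg_powr' p e u) (at u)"
proof (cases "u = 0")
  case True
  have "((\<lambda>s. (s + e) powr p) has_real_derivative p * e powr (p - 1)) (at 0 within {0..})"
    using assms by (intro shifted_powr_right_derivative) auto
  from DERIV_diff[OF DERIV_diff[OF this DERIV_const] DERIV_cmult[OF DERIV_ident]]
  have "((\<lambda>s. (s + e) powr p - e powr p - p * e powr (p - 1) * s) has_real_derivative 0)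
      (at 0 within {0..})"
    by (rule DERIV_cong) simp
  from has_real_derivative_even_ext[OF this] show ?thesis
    by (simp add: True reg_powr_def[abs_def])
next
  case False
  then have pos: "\<bar>u\<bar> + e > 0" using assms by auto
  note abs = has_real_derivative_abs[OF False]
  have "((\<lambda>u. (\<bar>u\<bar> + e) powr p) has_real_derivative p * (\<bar>u\<bar> + e) powr (p - 1) * sgn u) (at u)"
    using DERIV_add[OF abs DERIV_const[of e]]
    by (intro DERIV_chain2[where g = "\<lambda>u. \<bar>u\<bar> + e", OF has_real_derivative_powr[OF pos]]) simp
  from DERIV_diff[OF DERIV_diff[OF this DERIV_const] DERIV_cmult[OF abs]] show ?thesis
    unfolding reg_powr_def[abs_def] reg_powr'_def by (rule DERIV_cong) (simp add: algebra_simps)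
qed

lemma reg_powr'_deriv:
  assumes "1 < p" "0 \<le> e" "0 < e \<or> 2 < p"
  shows "(reg_powr' p e has_real_derivative reg_powr'' p e u) (at u)"
proof (cases "u = 0")
  case True
  have "((\<lambda>s. (s + e) powr (p - 1)) has_real_derivative (p - 1) * e powr (p - 1 - 1))
      (at 0 within {0..})"
    using assms by (intro shifted_powr_right_derivative) auto
  from DERIV_cmult[OF DERIV_diff[OF this DERIV_const]]
  have "((\<lambda>s. p * ((s + e) powr (p - 1) - e powr (p - 1))) has_real_derivative
      p * (p - 1) * e powr (p - 2)) (at 0 within {0..})"
    by (rule DERIV_cong) simp
  from has_real_derivative_odd_ext[OF this] show ?thesis
    by (simp add: True reg_powr'_def[abs_def] reg_powr''_def)
next
  case False
  then have pos: "\<bar>u\<bar> + e > 0" using assms by auto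
  have "((\<lambda>u. (\<bar>u\<bar> + e) powr (p - 1)) has_real_derivative
      (p - 1) * (\<bar>u\<bar> + e) powr (p - 1 - 1) * sgn u) (at u)"
    using DERIV_add[OF has_real_derivative_abs[OF False] DERIV_const[of e]]
    by (intro DERIV_chain2[where g = "\<lambda>u. \<bar>u\<bar> + e", OF has_real_derivative_powr[OF pos]]) simp
  from DERIV_cmult[OF DERIV_cmult[OF DERIV_diff[OF this DERIV_const]]]
  have "((\<lambda>v. sgn u * (p * ((\<bar>v\<bar> + e) powr (p - 1) - e powr (p - 1))))
      has_real_derivative reg_powr'' p e u) (at u)"
    by (rule DERIV_cong) (use False in \<open>simp add: reg_powr''_def sgn_if\<close>)
  then show ?thesis
    unfolding reg_powr'_def[abs_def]
    by (rule has_field_derivative_transform_within_open[where S = "if 0 < u then {0<..} else {..<0}"])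
      (use False in \<open>auto split: if_splits\<close>)
qed

lemma reg_powr''_continuous:
  assumes "0 \<le> e" "0 < e \<or> 2 < p"
  shows "continuous_on UNIV (reg_powr'' p e)"
  using assms unfolding reg_powr''_def[abs_def]
  by (intro continuous_on_mult continuous_on_const continuous_on_powr' continuous_on_add
      continuous_on_rabs continuous_on_id) auto

lemma reg_powr_continuous:
  assumes "1 < p" "0 \<le> e"
  shows "continuous_on UNIV (reg_powr p e)"
  by (meson DERIV_isCont assms continuous_at_imp_continuous_on reg_powr_deriv)

lemma reg_powr''_nonneg: "1 < p \<Longrightarrow> 0 \<le> reg_powr'' p e u"
  by (simp add: reg_powr''_def)

text \<open>
  For \<open>q \<le> 1\<close> a number in the unit interval is at most its power \<open>q\<close>; apply this to the two
  fractions \<open>a / (a + b)\<close> and \<open>b / (a + b)\<close>.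
\<close>
lemma powr_add_le:
  fixes a b q :: real
  assumes "0 \<le> a" "0 \<le> b" "0 < q" "q \<le> 1"
  shows "(a + b) powr q \<le> a powr q + b powr q"
proof (cases "a + b = 0")
  case True
  then show ?thesis using assms by (simp add: add_nonneg_eq_0_iff)
next
  case False
  then have s: "0 < a + b" using assms by linarith
  have *: "x / (a + b) * (a + b) powr q \<le> x powr q" if "0 \<le> x" "x \<le> a + b" for x
  proof -
    have "x / (a + b) = (x / (a + b)) powr 1" using that s by simp
    also have "\<dots> \<le> (x / (a + b)) powr q"
      using that s assms by (intro powr_mono') auto
    also have "\<dots> = x powr q / (a + b) powr q" using that s by (simp add: powr_divide)
    finally show ?thesis using s by (simp add: field_simps)
  qed
  have "(a + b) powr q = a / (a + b) * (a + b) powr q + b / (a + b) * (a + b) powr q"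
    using s by (simp flip: distrib_right add_divide_distrib)
  also have "\<dots> \<le> a powr q + b powr q"
    using *[of a] *[of b] assms by simp
  finally show ?thesis .
qed

text \<open>
  Both bounds compare derivatives on the positive half line, all the functions being \<open>0\<close> at \<open>0\<close>.
  The upper one needs \<open>(x + e) powr (p - 1) - e powr (p - 1) \<le> x powr (p - 1)\<close>, which is
  subadditivity and restricts a positive shift to \<open>p \<le> 2\<close>.
\<close>
lemma reg_powr_bounds:
  assumes "1 < p" "0 \<le> e" "e = 0 \<or> p \<le> 2"
  shows "0 \<le> reg_powr p e u" "reg_powr p e u \<le> \<bar>u\<bar> powr p"
proof -
  have d: "\<exists>y. (reg_powr p e has_real_derivative y) (at x) \<and> 0 \<le> y" if "0 \<le> x" for x
    using reg_powr_deriv[of p e x] assms that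
    by (intro exI[of _ "reg_powr' p e x"])
       (auto simp: reg_powr'_def sgn_if intro!: powr_mono2 mult_nonneg_nonneg)
  have "reg_powr p e 0 \<le> reg_powr p e \<bar>u\<bar>"
    by (rule DERIV_nonneg_imp_nondecreasing) (use d in auto)
  then show "0 \<le> reg_powr p e u" by (simp add: reg_powr_def)
  have "reg_powr p 0 0 - reg_powr p e 0 \<le> reg_powr p 0 (abs u) - reg_powr p e (abs u)"
  proof (rule DERIV_nonneg_imp_nondecreasing[where f = "\<lambda>x. reg_powr p 0 x - reg_powr p e x"])
    fix x assume x: "0 \<le> x" "x \<le> abs u"
    have "e = 0 \<or> (x + e) powr (p - 1) \<le> x powr (p - 1) + e powr (p - 1)"
      using powr_add_le[of x e "p - 1"] assms x by auto
    then have "0 \<le> reg_powr' p 0 x - reg_powr' p e x"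
      using x assms by (auto simp: reg_powr'_def sgn_if simp flip: right_diff_distrib)
    moreover have "((\<lambda>x. reg_powr p 0 x - reg_powr p e x) has_real_derivative
        reg_powr' p 0 x - reg_powr' p e x) (at x)"
      by (intro DERIV_diff reg_powr_deriv) (use assms in auto)
    ultimately show "\<exists>y. ((\<lambda>x. reg_powr p 0 x - reg_powr p e x) has_real_derivative y) (at x) \<and> 0 \<le> y"
      by blast
  qed simp
  then show "reg_powr p e u \<le> \<bar>u\<bar> powr p" by (simp add: reg_powr_def)
qed

text \<open>
  A positive shift is needed for \<open>p < 2\<close>, where the second derivative of the power is singular, and
  for \<open>p = 2\<close>, where \<open>0 powr 0 = 0\<close> would give it a wrong value at \<open>0\<close>. For \<open>p > 2\<close> the shift has to
  vanish: otherwise \<open>reg_powr p e u\<close> is of order \<open>u\<^sup>2\<close> near \<open>0\<close> and is not dominated by \<open>\<bar>u\<bar> powr p\<close>.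
\<close>
definition reg_eps :: "real \<Rightarrow> nat \<Rightarrow> real" where
  "reg_eps p n = (if p \<le> 2 then inverse (real (Suc n)) else 0)"

lemma reg_eps:
  "0 \<le> reg_eps p n" "0 < reg_eps p n \<or> 2 < p" "reg_eps p n = 0 \<or> p \<le> 2"
  by (auto simp: reg_eps_def)

lemma reg_eps_tendsto: "reg_eps p \<longlonglongrightarrow> 0"
  using LIMSEQ_inverse_real_of_nat by (cases "p \<le> 2") (simp_all add: reg_eps_def[abs_def])

lemma reg_powr_tendsto:
  assumes "1 < p"
  shows "(\<lambda>n. reg_powr p (reg_eps p n) u) \<longlonglongrightarrow> \<bar>u\<bar> powr p"
proof -
  have [tendsto_intros]: "(\<lambda>n. reg_eps p n) \<longlonglongrightarrow> 0" using reg_eps_tendsto .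
  have "(\<lambda>n. (\<bar>u\<bar> + reg_eps p n) powr p) \<longlonglongrightarrow> \<bar>u\<bar> powr p"
    using assms by (auto intro!: tendsto_eq_intros always_eventually reg_eps)
  moreover have "(\<lambda>n. reg_eps p n powr p) \<longlonglongrightarrow> 0" "(\<lambda>n. reg_eps p n powr (p - 1)) \<longlonglongrightarrow> 0"
    using assms by (auto intro!: tendsto_eq_intros always_eventually reg_eps)
  ultimately have "(\<lambda>n. (\<bar>u\<bar> + reg_eps p n) powr p - reg_eps p n powr p
      - p * reg_eps p n powr (p - 1) * \<bar>u\<bar>) \<longlonglongrightarrow> \<bar>u\<bar> powr p - 0 - p * 0 * \<bar>u\<bar>"
    by (intro tendsto_diff tendsto_mult tendsto_const)
  then show ?thesis by (simp add: reg_powr_def)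
qed

lemma reg_powr''_mono:
  assumes "1 < p" "m \<le> n"
  shows "reg_powr'' p (reg_eps p m) u \<le> reg_powr'' p (reg_eps p n) u"
proof (cases "p \<le> 2")
  case True
  have "(\<bar>u\<bar> + reg_eps p m) powr (p - 2) \<le> (\<bar>u\<bar> + reg_eps p n) powr (p - 2)"
    using True assms(2)
    by (intro powr_mono2') (auto simp: reg_eps_def add_nonneg_pos intro!: le_imp_inverse_le)
  then show ?thesis using assms by (simp add: reg_powr''_def)
qed (simp add: reg_eps_def)

text \<open>
  The convergence includes \<open>u = 0\<close>, where for \<open>p < 2\<close> the limit is infinite. Together with
  \<open>reg_powr''_mono\<close> it produces the convention for the power of zero by monotone
  convergence, whatever the measure of the zero set of the semigroup.
\<close>
lemma reg_powr''_tendsto: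
  assumes "1 < p"
  shows "(\<lambda>n. ennreal (reg_powr'' p (reg_eps p n) u))
    \<longlonglongrightarrow> ennreal (p * (p - 1)) * epowr \<bar>u\<bar> (p - 2)"
proof (cases "u = 0")
  case False
  have [tendsto_intros]: "(\<lambda>n. reg_eps p n) \<longlonglongrightarrow> 0" using reg_eps_tendsto .
  have "(\<lambda>n. reg_powr'' p (reg_eps p n) u) \<longlonglongrightarrow> p * (p - 1) * \<bar>u\<bar> powr (p - 2)"
    unfolding reg_powr''_def using False by (auto intro!: tendsto_eq_intros)
  then have "(\<lambda>n. ennreal (reg_powr'' p (reg_eps p n) u)) \<longlonglongrightarrow> ennreal (p * (p - 1) * \<bar>u\<bar> powr (p - 2))"
    by (rule tendsto_ennrealI)
  then show ?thesis using False assms by (simp add: epowr_def ennreal_mult)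
next
  case True
  consider "p < 2" | "p = 2" | "p > 2" by linarith
  then show ?thesis
  proof cases
    case 1
    have "filterlim (\<lambda>n. p * (p - 1) * real (Suc n) powr (2 - p)) at_top sequentially"
      using 1 assms by real_asymp
    moreover have "p * (p - 1) * real (Suc n) powr (2 - p) = reg_powr'' p (reg_eps p n) u" for n
    proof -
      have "inverse (real (Suc n)) powr (p - 2) = real (Suc n) powr (2 - p)"
        using powr_powr[of "real (Suc n)" "-1" "p - 2"] by (simp add: powr_minus)
      then show ?thesis using 1 True by (simp add: reg_powr''_def reg_eps_def)
    qed
    ultimately have "filterlim (\<lambda>n. reg_powr'' p (reg_eps p n) u) at_top sequentially" by simp
    then have "(\<lambda>n. ennreal (reg_powr'' p (reg_eps p n) u)) \<longlonglongrightarrow> \<infinity>"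
      by (simp add: ennreal_tendsto_top_eq_at_top)
    then show ?thesis using 1 True assms by (simp add: epowr_def ennreal_mult_top)
  next
    case 2
    then show ?thesis using True by (auto simp: reg_powr''_def reg_eps_def epowr_def)
  next
    case 3
    then show ?thesis using True by (simp add: reg_powr''_def reg_eps_def epowr_def)
  qed
qed

lemma convex_abs_powr:
  fixes p :: real
  assumes "1 < p"
  shows "convex_on UNIV (\<lambda>u::real. \<bar>u\<bar> powr p)"
proof -
  have "reg_powr' p 0 x \<le> reg_powr' p 0 y" if "x \<le> y" for x y :: real
  proof -
    have "x \<le> 0 \<and> 0 \<le> y \<or> 0 \<le> x \<or> y \<le> 0" by linarith
    then show ?thesis using that assms
      by (auto simp: reg_powr'_def sgn_if intro!: powr_mono2 order_trans[OF neg_le_0_iff_le[THEN iffD2, OF powr_ge_zero]])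
  qed
  then have "convex_on UNIV (reg_powr p 0)"
    using reg_powr_deriv[OF assms order_refl]
    by (intro convex_on_realI[where f' = "reg_powr' p 0"]) auto
  then show ?thesis by (simp add: reg_powr_eps0[abs_def])
qed

text \<open>
  Convexity of the power at \<open>a + b = (1 - l) (a / (1 - l)) + l (b / l)\<close>. This does the work of
  Minkowski's inequality without taking roots: the constant in front of \<open>\<bar>a\<bar> powr p\<close> tends to \<open>1\<close>
  as \<open>l\<close> tends to \<open>0\<close>.
\<close>
lemma abs_powr_add_le:
  fixes a b p l :: real
  assumes "1 < p" "0 < l" "l < 1"
  shows "\<bar>a + b\<bar> powr p \<le> (1 - l) powr (1 - p) * \<bar>a\<bar> powr p + l powr (1 - p) * \<bar>b\<bar> powr p"
proof -
  have "\<bar>(1 - l) *\<^sub>R (a / (1 - l)) + l *\<^sub>R (b / l)\<bar> powr p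
      \<le> (1 - l) * \<bar>a / (1 - l)\<bar> powr p + l * \<bar>b / l\<bar> powr p"
    using convex_onD[OF convex_abs_powr[OF assms(1)], of l "a / (1 - l)" "b / l"] assms by simp
  moreover have "c * \<bar>x / c\<bar> powr p = c powr (1 - p) * \<bar>x\<bar> powr p" if "0 < c" for c x :: real
    using that by (simp add: abs_divide powr_divide powr_diff)
  then have "(1 - l) * \<bar>a / (1 - l)\<bar> powr p = (1 - l) powr (1 - p) * \<bar>a\<bar> powr p"
    and "l * \<bar>b / l\<bar> powr p = l powr (1 - p) * \<bar>b\<bar> powr p"
    using assms by auto
  moreover have "(1 - l) *\<^sub>R (a / (1 - l)) + l *\<^sub>R (b / l) = a + b"
    using assms by simp
  ultimately show ?thesis by simp
qed

section \<open>Integrals depending on a parameter\<close>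

lemma isCont_integral_dominated:
  fixes K :: "'z::metric_space \<Rightarrow> 'b \<Rightarrow> real"
  assumes meas: "\<And>z. K z \<in> borel_measurable M"
    and G: "integrable M G"
    and cont: "\<And>y. y \<in> space M \<Longrightarrow> isCont (\<lambda>z. K z y) z0"
    and bound: "\<forall>\<^sub>F z in nhds z0. \<forall>y\<in>space M. \<bar>K z y\<bar> \<le> G y"
  shows "isCont (\<lambda>z. \<integral>y. K z y \<partial>M) z0"
  unfolding continuous_at_sequentially
proof (intro allI impI)
  fix X assume X: "X \<longlonglongrightarrow> z0"
  then have "\<forall>\<^sub>F n in sequentially. \<forall>y\<in>space M. \<bar>K (X n) y\<bar> \<le> G y"
    using bound unfolding filterlim_iff by blast
  then obtain N where N: "\<And>n y. n \<ge> N \<Longrightarrow> y \<in> space M \<Longrightarrow> \<bar>K (X n) y\<bar> \<le> G y"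
    by (auto simp: eventually_sequentially)
  have "(\<lambda>n. \<integral>y. K (X (n + N)) y \<partial>M) \<longlonglongrightarrow> (\<integral>y. K z0 y \<partial>M)"
  proof (rule integral_dominated_convergence[where w = G])
    show "AE y in M. (\<lambda>n. K (X (n + N)) y) \<longlonglongrightarrow> K z0 y"
    proof (rule AE_I2)
      fix y assume "y \<in> space M"
      then have "(\<lambda>n. K (X n) y) \<longlonglongrightarrow> K z0 y"
        using isCont_tendsto_compose[OF cont X] by blast
      then show "(\<lambda>n. K (X (n + N)) y) \<longlonglongrightarrow> K z0 y" by (rule LIMSEQ_ignore_initial_segment)
    qed
    show "AE y in M. norm (K (X (n + N)) y) \<le> G y" for n
      using N[of "n + N"] by auto
  qed (use meas G in auto)
  then show "((\<lambda>z. \<integral>y. K z y \<partial>M) \<circ> X) \<longlonglongrightarrow> (\<integral>y. K z0 y \<partial>M)"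
    unfolding comp_def by (rule LIMSEQ_offset)
qed

text \<open>
  By the mean value theorem the difference quotient minus the linear term is at most \<open>2 * G y\<close>, so
  dominated convergence along sequences tending to \<open>z0\<close> applies.
\<close>
lemma has_derivative_integral_dominated:
  fixes K :: "'z::euclidean_space \<Rightarrow> 'b \<Rightarrow> real"
  assumes meas: "\<And>z. K z \<in> borel_measurable M"
    and meas': "\<And>h. (\<lambda>y. K' z0 y h) \<in> borel_measurable M"
    and G: "integrable M G"
    and int: "\<And>z. z \<in> ball z0 r \<Longrightarrow> integrable M (K z)"
    and r: "0 < r"
    and deriv: "\<And>z y. z \<in> ball z0 r \<Longrightarrow> y \<in> space M \<Longrightarrow> ((\<lambda>z. K z y) has_derivative K' z y) (at z)"
    and bound: "\<And>z y h. z \<in> ball z0 r \<Longrightarrow> y \<in> space M \<Longrightarrow> \<bar>K' z y h\<bar> \<le> G y * norm h"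
  shows "((\<lambda>z. \<integral>y. K z y \<partial>M) has_derivative (\<lambda>h. \<integral>y. K' z0 y h \<partial>M)) (at z0)"
proof -
  have z0: "z0 \<in> ball z0 r" using r by simp
  have lin: "bounded_linear (K' z0 y)" if "y \<in> space M" for y
    using deriv[OF z0 that] by (rule has_derivative_bounded_linear)
  have int': "integrable M (\<lambda>y. K' z0 y h)" for h
    by (rule Bochner_Integration.integrable_bound[OF integrable_mult_left[OF G, of "norm h"] meas'])
       (use bound[OF z0] in \<open>auto intro!: order_trans[OF bound[OF z0] abs_ge_self]\<close>)
  have "bounded_linear (\<lambda>h. \<integral>y. K' z0 y h \<partial>M)"
  proof (rule bounded_linear_intro)
    fix x y
    have "(\<integral>w. K' z0 w (x + y) \<partial>M) = (\<integral>w. K' z0 w x + K' z0 w y \<partial>M)"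
      by (intro Bochner_Integration.integral_cong refl linear_add bounded_linear.linear lin)
    then show "(\<integral>w. K' z0 w (x + y) \<partial>M) = (\<integral>w. K' z0 w x \<partial>M) + (\<integral>w. K' z0 w y \<partial>M)"
      using int' by simp
  next
    fix c x
    have "(\<integral>w. K' z0 w (c *\<^sub>R x) \<partial>M) = (\<integral>w. c *\<^sub>R K' z0 w x \<partial>M)"
      by (intro Bochner_Integration.integral_cong refl linear_scale bounded_linear.linear lin)
    then show "(\<integral>w. K' z0 w (c *\<^sub>R x) \<partial>M) = c *\<^sub>R (\<integral>w. K' z0 w x \<partial>M)" by simp
  next
    fix x
    have "\<bar>\<integral>w. K' z0 w x \<partial>M\<bar> \<le> (\<integral>w. \<bar>K' z0 w x\<bar> \<partial>M)" by (rule integral_abs_bound)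
    also have "\<dots> \<le> (\<integral>w. G w * norm x \<partial>M)"
      by (intro integral_mono bound z0 int' integrable_abs integrable_mult_left G)
    also have "\<dots> = norm x * (\<integral>w. G w \<partial>M)" by simp
    finally show "norm (\<integral>w. K' z0 w x \<partial>M) \<le> norm x * (\<integral>w. G w \<partial>M)" by simp
  qed
  moreover have "((\<lambda>z. ((\<integral>y. K z y \<partial>M) - (\<integral>y. K z0 y \<partial>M) - (\<integral>y. K' z0 y (z - z0) \<partial>M)) /\<^sub>R norm (z - z0)) \<longlongrightarrow> 0) (at z0)"
    unfolding tendsto_at_iff_sequentially comp_def
  proof (intro allI impI)
    fix X assume X0: "\<forall>i. X i \<in> UNIV - {z0}" and X: "X \<longlonglongrightarrow> z0"
    then obtain N where N: "\<And>n. n \<ge> N \<Longrightarrow> X n \<in> ball z0 r"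
      using r by (metis (no_types, lifting) eventually_sequentially centre_in_ball open_ball topological_tendstoD)
    define D where "D n y = (K (X (n + N)) y - K z0 y - K' z0 y (X (n + N) - z0)) /\<^sub>R norm (X (n + N) - z0)" for n y
    have XN: "X (n + N) \<in> ball z0 r" for n using N[of "n + N"] by simp
    have "(\<lambda>n. \<integral>y. D n y \<partial>M) \<longlonglongrightarrow> (\<integral>y. 0 \<partial>M)"
    proof (rule integral_dominated_convergence[where w = "\<lambda>y. 2 * G y"])
      show "AE y in M. (\<lambda>n. D n y) \<longlonglongrightarrow> 0"
      proof (rule AE_I2)
        fix y assume y: "y \<in> space M"
        have "((\<lambda>z. (K z y - K z0 y - K' z0 y (z - z0)) /\<^sub>R norm (z - z0)) \<longlongrightarrow> 0) (at z0)"
          using deriv[OF z0 y] unfolding has_derivative_at_within by blast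
        then have "(\<lambda>n. (K (X n) y - K z0 y - K' z0 y (X n - z0)) /\<^sub>R norm (X n - z0)) \<longlonglongrightarrow> 0"
          unfolding tendsto_at_iff_sequentially comp_def using X X0 by blast
        then show "(\<lambda>n. D n y) \<longlonglongrightarrow> 0"
          unfolding D_def by (rule LIMSEQ_ignore_initial_segment)
      qed
      show "AE y in M. norm (D n y) \<le> 2 * G y" for n
      proof (rule AE_I2)
        fix y assume y: "y \<in> space M"
        let ?x = "X (n + N)"
        have pos: "0 < norm (?x - z0)" using X0 by simp
        have "norm (K ?x y - K z0 y) \<le> G y * norm (?x - z0)"
        proof (rule differentiable_bound[where S = "ball z0 r" and f' = "\<lambda>z. K' z y"])
          fix z assume z: "z \<in> ball z0 r"
          show "((\<lambda>z. K z y) has_derivative K' z y) (at z within ball z0 r)"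
            using deriv[OF z y] by (rule has_derivative_at_withinI)
          show "onorm (K' z y) \<le> G y"
            using bound[OF z y] by (intro onorm_le) simp
        qed (use XN z0 in auto)
        moreover have "\<bar>K' z0 y (?x - z0)\<bar> \<le> G y * norm (?x - z0)"
          by (rule bound[OF z0 y])
        ultimately have "\<bar>K ?x y - K z0 y - K' z0 y (?x - z0)\<bar> \<le> 2 * G y * norm (?x - z0)" by simp
        then show "norm (D n y) \<le> 2 * G y"
          using pos by (simp add: D_def abs_mult field_simps)
      qed
      show "integrable M (\<lambda>y. 2 * G y)" using G by simp
      show "D n \<in> borel_measurable M" for n
        unfolding D_def[abs_def] using meas meas' by measurable
    qed simp
    moreover have "(\<integral>y. D n y \<partial>M) = ((\<integral>y. K (X (n + N)) y \<partial>M) - (\<integral>y. K z0 y \<partial>M) -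
        (\<integral>y. K' z0 y (X (n + N) - z0) \<partial>M)) /\<^sub>R norm (X (n + N) - z0)" for n
      unfolding D_def using int[OF XN] int[OF z0] int' by simp
    ultimately have "(\<lambda>n. ((\<integral>y. K (X (n + N)) y \<partial>M) - (\<integral>y. K z0 y \<partial>M) -
        (\<integral>y. K' z0 y (X (n + N) - z0) \<partial>M)) /\<^sub>R norm (X (n + N) - z0)) \<longlonglongrightarrow> 0" by simp
    then show "(\<lambda>n. ((\<integral>y. K (X n) y \<partial>M) - (\<integral>y. K z0 y \<partial>M) -
        (\<integral>y. K' z0 y (X n - z0) \<partial>M)) /\<^sub>R norm (X n - z0)) \<longlonglongrightarrow> 0"
      by (rule LIMSEQ_offset)
  qed
  ultimately show ?thesis
    unfolding has_derivative_at_within by blast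
qed

lemma DERIV_integral_dominated:
  fixes K :: "real \<Rightarrow> 'b \<Rightarrow> real"
  assumes meas: "\<And>t. K t \<in> borel_measurable M"
    and meas': "K' t0 \<in> borel_measurable M"
    and G: "integrable M G"
    and int: "\<And>t. t \<in> ball t0 r \<Longrightarrow> integrable M (K t)"
    and r: "0 < r"
    and deriv: "\<And>t y. t \<in> ball t0 r \<Longrightarrow> y \<in> space M \<Longrightarrow> ((\<lambda>t. K t y) has_real_derivative K' t y) (at t)"
    and bound: "\<And>t y. t \<in> ball t0 r \<Longrightarrow> y \<in> space M \<Longrightarrow> \<bar>K' t y\<bar> \<le> G y"
  shows "((\<lambda>t. \<integral>y. K t y \<partial>M) has_real_derivative (\<integral>y. K' t0 y \<partial>M)) (at t0)"
proof -
  have "((\<lambda>t. \<integral>y. K t y \<partial>M) has_derivative (\<lambda>h. \<integral>y. K' t0 y * h \<partial>M)) (at t0)"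
  proof (rule has_derivative_integral_dominated[where K' = "\<lambda>t y h. K' t y * h", OF meas _ G int r])
    fix t y h assume *: "t \<in> ball t0 r" "y \<in> space M"
    show "((\<lambda>t. K t y) has_derivative (*) (K' t y)) (at t)"
      using deriv[OF *] by (simp add: has_field_derivative_def)
    show "\<bar>K' t y * h\<bar> \<le> G y * norm h"
      using bound[OF *] by (simp add: abs_mult mult_right_mono)
  qed (use meas' in auto)
  then show ?thesis
    by (simp add: has_field_derivative_def mult.commute[of _ "integral\<^sup>L M (K' t0)"])
qed

section \<open>The integral of a compactly supported directional derivative\<close>

lemma integrable_continuous_bounded_support:
  fixes F :: "'a::euclidean_space \<Rightarrow> real"
  assumes "continuous_on UNIV F" and "\<And>x. R < norm x \<Longrightarrow> F x = 0"
  shows "integrable lborel F"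
proof -
  have "integrable lborel (\<lambda>x. indicator (cball 0 R) x *\<^sub>R F x)"
    by (rule borel_integrable_compact[unfolded set_integrable_def])
      (use assms in \<open>auto intro: continuous_on_subset\<close>)
  moreover have "(\<lambda>x. indicator (cball 0 R) x *\<^sub>R F x) = F"
    using assms(2) by (intro ext) (auto simp: indicator_def not_le)
  ultimately show ?thesis by metis
qed

lemma continuous_bounded_support_bound:
  fixes F :: "'a::euclidean_space \<Rightarrow> real"
  assumes "continuous_on UNIV F" and "\<And>x. R < norm x \<Longrightarrow> F x = 0"
  obtains C where "0 \<le> C" "\<And>x. \<bar>F x\<bar> \<le> C"
proof -
  have "compact (F ` cball 0 R)"
    using assms(1) by (intro compact_continuous_image) (auto intro: continuous_on_subset)
  then obtain C where C: "0 < C" "\<And>x. norm x \<le> R \<Longrightarrow> \<bar>F x\<bar> \<le> C"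
    by (auto simp: bounded_pos dest!: compact_imp_bounded)
  then have "\<bar>F x\<bar> \<le> C" for x
    using assms(2)[of x] by (cases "norm x \<le> R") auto
  with that[of C] C(1) show ?thesis by simp
qed

lemma lborel_integral_translation:
  fixes F :: "'a::euclidean_space \<Rightarrow> real"
  assumes [measurable]: "F \<in> borel_measurable borel"
  shows "(\<integral>x. F (x + a) \<partial>lborel) = (\<integral>x. F x \<partial>lborel)"
proof -
  have "(\<integral>x. F x \<partial>lborel) = (\<integral>x. F x \<partial>distr lborel borel ((+) a))"
    by (simp add: lborel_distr_plus)
  also have "\<dots> = (\<integral>x. F (a + x) \<partial>lborel)"
    by (rule integral_distr) auto
  finally show ?thesis by (simp add: add.commute)
qed

text \<open>
  The integral of \<open>F (x + s *\<^sub>R e)\<close> over \<open>x\<close> does not depend on \<open>s\<close>; differentiate it under the integral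
  at \<open>s = 0\<close>. This is the only form of the divergence theorem that is used.
\<close>
lemma integral_directional_derivative_eq_0:
  fixes F F' :: "'a::euclidean_space \<Rightarrow> real"
  assumes deriv: "\<And>x. ((\<lambda>s. F (x + s *\<^sub>R e)) has_real_derivative F' x) (at 0)"
    and cont: "continuous_on UNIV F" and cont': "continuous_on UNIV F'"
    and supp: "\<And>x. R < norm x \<Longrightarrow> F x = 0"
    and supp': "\<And>x. R < norm x \<Longrightarrow> F' x = 0"
  shows "(\<integral>x. F' x \<partial>lborel) = 0"
proof -
  obtain C where C: "0 \<le> C" "\<And>x. \<bar>F' x\<bar> \<le> C"
    using continuous_bounded_support_bound[OF cont' supp'] by blast
  have [measurable]: "F \<in> borel_measurable borel" "F' \<in> borel_measurable borel"
    using cont cont' by (auto intro: borel_measurable_continuous_onI)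
  have "((\<lambda>s. \<integral>x. F (x + s *\<^sub>R e) \<partial>lborel) has_real_derivative
      (\<integral>x. F' (x + 0 *\<^sub>R e) \<partial>lborel)) (at 0)"
  \<comment> \<open>For \<open>\<bar>s\<bar> < 1\<close> the support of the translated function stays in the ball of radius \<open>R + norm e\<close>.\<close>
  proof (rule DERIV_integral_dominated[where r = 1 and G = "\<lambda>x. C * indicator (cball 0 (R + norm e)) x"])
    show "integrable lborel (\<lambda>x. C * indicator (cball 0 (R + norm e)) x :: real)"
      using emeasure_bounded_finite[OF bounded_cball, of 0 "R + norm e"]
      by (intro integrable_mult_right integrable_real_indicator) auto
    show "integrable lborel (\<lambda>x. F (x + s *\<^sub>R e))" for s
    proof (rule integrable_continuous_bounded_support[where R = "R + norm (s *\<^sub>R e)"])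
      show "continuous_on UNIV (\<lambda>x. F (x + s *\<^sub>R e))"
        using cont by (auto intro!: continuous_intros continuous_on_compose2[OF cont])
      show "F (x + s *\<^sub>R e) = 0" if "R + norm (s *\<^sub>R e) < norm x" for x
        using that norm_triangle_ineq4[of "x + s *\<^sub>R e" "s *\<^sub>R e"] by (intro supp) auto
    qed
    fix s :: real and x assume s: "s \<in> ball 0 1"
    show "((\<lambda>s. F (x + s *\<^sub>R e)) has_real_derivative F' (x + s *\<^sub>R e)) (at s)"
      using deriv[of "x + s *\<^sub>R e"] DERIV_shift[of "\<lambda>s. F (x + s *\<^sub>R e)" "F' (x + s *\<^sub>R e)" 0 s]
      by (simp add: algebra_simps)
    have "norm x \<le> R + norm e" if "norm (x + s *\<^sub>R e) \<le> R"
    proof -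
      have "norm x \<le> norm (x + s *\<^sub>R e) + \<bar>s\<bar> * norm e"
        using norm_triangle_ineq4[of "x + s *\<^sub>R e" "s *\<^sub>R e"] by simp
      also have "\<bar>s\<bar> * norm e \<le> 1 * norm e"
        using s by (intro mult_right_mono) auto
      finally show ?thesis using that by simp
    qed
    then show "\<bar>F' (x + s *\<^sub>R e)\<bar> \<le> C * indicator (cball 0 (R + norm e)) x"
      using C supp'[of "x + s *\<^sub>R e"]
      by (cases "norm (x + s *\<^sub>R e) \<le> R") (auto simp: indicator_def)
  qed auto
  moreover have "(\<integral>x. F (x + s *\<^sub>R e) \<partial>lborel) = (\<integral>x. F x \<partial>lborel)" for s
    by (rule lborel_integral_translation) simp
  ultimately show ?thesis
    using DERIV_unique[OF _ DERIV_const] by fastforce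
qed

section \<open>The heat kernel\<close>

definition heat_kernel_dt :: "real \<Rightarrow> 'a::euclidean_space \<Rightarrow> real" where
  "heat_kernel_dt t x = ((norm x)\<^sup>2 / (4 * t\<^sup>2) - DIM('a) / (2 * t)) * heat_kernel t x"

definition heat_kernel_dx :: "'a \<Rightarrow> real \<Rightarrow> 'a::euclidean_space \<Rightarrow> real" where
  "heat_kernel_dx e t x = - (x \<bullet> e) / (2 * t) * heat_kernel t x"

definition heat_kernel_dxx :: "'a \<Rightarrow> 'a \<Rightarrow> real \<Rightarrow> 'a::euclidean_space \<Rightarrow> real" where
  "heat_kernel_dxx e h t x = ((x \<bullet> e) * (x \<bullet> h) / (4 * t\<^sup>2) - (e \<bullet> h) / (2 * t)) * heat_kernel t x"

text \<open>
  One majorant for the kernel and for all its derivatives that occur: the factor \<open>1 + (norm x)\<^sup>2\<close>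
  absorbs the polynomials in \<open>x\<close>, and \<open>(1 + 1 / t)\<^sup>2\<close> the negative powers of \<open>t\<close>.
\<close>
definition heat_dom :: "real \<Rightarrow> 'a::euclidean_space \<Rightarrow> real" where
  "heat_dom t x = (1 + (norm x)\<^sup>2) * (1 + 1 / t)\<^sup>2 * heat_kernel t x"

lemma heat_kernel_nonneg: "0 \<le> heat_kernel t x"
  by (simp add: heat_kernel_def)

lemma heat_kernel_measurable [measurable]:
  "(\<lambda>x::'a::euclidean_space. heat_kernel t x) \<in> borel_measurable borel"
  "(\<lambda>x::'a. heat_kernel_dt t x) \<in> borel_measurable borel"
  "(\<lambda>x::'a. heat_kernel_dx e t x) \<in> borel_measurable borel"
  "(\<lambda>x::'a. heat_kernel_dxx e h t x) \<in> borel_measurable borel"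
  unfolding heat_kernel_def heat_kernel_dt_def heat_kernel_dx_def heat_kernel_dxx_def
  by measurable

lemma heat_kernel_continuous:
  "continuous_on ({0<..} \<times> UNIV) (\<lambda>(t, x::'a::euclidean_space). heat_kernel t x)"
  "continuous_on ({0<..} \<times> UNIV) (\<lambda>(t, x::'a::euclidean_space). heat_kernel_dt t x)"
  "continuous_on ({0<..} \<times> UNIV) (\<lambda>(t, x::'a::euclidean_space). heat_kernel_dx e t x)"
  "continuous_on ({0<..} \<times> UNIV) (\<lambda>(t, x::'a::euclidean_space). heat_kernel_dxx e h t x)"
  unfolding heat_kernel_def heat_kernel_dt_def heat_kernel_dx_def heat_kernel_dxx_def split_def
  by (auto intro!: continuous_intros)

lemma heat_kernel_has_derivative_t:
  fixes x :: "'a::euclidean_space"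
  assumes "0 < t"
  shows "((\<lambda>t. heat_kernel t x) has_real_derivative heat_kernel_dt t x) (at t)"
proof -
  define k where "k = - real DIM('a) / 2"
  have "((\<lambda>t. (4 * pi * t) powr k) has_real_derivative k * (4 * pi * t) powr (k - 1) * (4 * pi)) (at t)"
    using assms by (auto intro!: derivative_eq_intros)
  moreover have "k * (4 * pi * t) powr (k - 1) * (4 * pi) = k / t * (4 * pi * t) powr k"
    using assms by (simp add: powr_diff)
  ultimately have 1: "((\<lambda>t. (4 * pi * t) powr k) has_real_derivative k / t * (4 * pi * t) powr k) (at t)"
    by simp
  have 2: "((\<lambda>t. exp (- (norm x)\<^sup>2 / (4 * t))) has_real_derivative
      exp (- (norm x)\<^sup>2 / (4 * t)) * ((norm x)\<^sup>2 / (4 * t\<^sup>2))) (at t)"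
    using assms by (auto intro!: derivative_eq_intros simp: power2_eq_square field_simps)
  from DERIV_mult[OF 1 2] show ?thesis
    unfolding heat_kernel_def[abs_def] heat_kernel_dt_def k_def[symmetric]
    by (rule DERIV_cong) (simp add: k_def algebra_simps)
qed

lemma heat_kernel_has_derivative_x:
  fixes x :: "'a::euclidean_space"
  assumes "0 < t"
  shows "(heat_kernel t has_derivative (\<lambda>h. heat_kernel_dx h t x)) (at x)"
proof -
  have "((\<lambda>x::'a. - (x \<bullet> x) / (4 * t)) has_derivative (\<lambda>h. - (x \<bullet> h) / (2 * t))) (at x)"
    using assms
    by (auto intro!: derivative_eq_intros ext simp: inner_commute field_simps)
  from has_derivative_mult_right[OF has_derivative_exp[OF this], of "(4 * pi * t) powr (- real DIM('a) / 2)"]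
  have "((\<lambda>x::'a. (4 * pi * t) powr (- real DIM('a) / 2) * exp (- (x \<bullet> x) / (4 * t))) has_derivative
      (\<lambda>h. (4 * pi * t) powr (- real DIM('a) / 2) * (- (x \<bullet> h) / (2 * t) * exp (- (x \<bullet> x) / (4 * t))))) (at x)" .
  then show ?thesis
    unfolding heat_kernel_def[abs_def] heat_kernel_dx_def power2_norm_eq_inner
    by (rule has_derivative_subst) (simp add: fun_eq_iff)
qed

lemma heat_kernel_dx_has_derivative:
  fixes x :: "'a::euclidean_space"
  assumes "0 < t"
  shows "(heat_kernel_dx e t has_derivative (\<lambda>h. heat_kernel_dxx e h t x)) (at x)"
proof -
  have "((\<lambda>x. - (x \<bullet> e) / (2 * t)) has_derivative (\<lambda>h. - (h \<bullet> e) / (2 * t))) (at x)"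
    using assms by (auto intro!: derivative_eq_intros)
  from has_derivative_mult[OF this heat_kernel_has_derivative_x[OF assms]] show ?thesis
    unfolding heat_kernel_dx_def[of e, abs_def]
    by (rule has_derivative_subst)
      (use assms in \<open>simp add: fun_eq_iff heat_kernel_dxx_def heat_kernel_dx_def power2_eq_square inner_commute field_simps\<close>)
qed

lemma heat_equation_kernel:
  fixes x :: "'a::euclidean_space"
  shows "heat_kernel_dt t x = (\<Sum>e\<in>Basis. heat_kernel_dxx e e t x)"
proof -
  have "(\<Sum>e\<in>Basis. heat_kernel_dxx e e t x) =
      (\<Sum>e\<in>Basis. (x \<bullet> e) * (x \<bullet> e) / (4 * t\<^sup>2) - 1 / (2 * t)) * heat_kernel t x"
    unfolding heat_kernel_dxx_def by (simp add: sum_distrib_right)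
  also have "(\<Sum>e\<in>Basis. (x \<bullet> e) * (x \<bullet> e) / (4 * t\<^sup>2) - 1 / (2 * t)) =
      (norm x)\<^sup>2 / (4 * t\<^sup>2) - DIM('a) / (2 * t)"
    by (simp add: sum_subtractf sum_divide_distrib[symmetric] euclidean_inner[symmetric]
        power2_norm_eq_inner)
  finally show ?thesis by (simp add: heat_kernel_dt_def)
qed

lemma le_1_plus_square: "(r::real) \<le> 1 + r\<^sup>2"
  using zero_le_power2[of "r - 1 / 2"] by (simp add: power2_eq_square algebra_simps)

lemma heat_dom_ge:
  assumes g: "\<bar>g\<bar> \<le> A * ((1 + (norm x)\<^sup>2) * (1 + 1 / t)\<^sup>2)"
  shows "\<bar>g * heat_kernel t x\<bar> \<le> A * heat_dom t x"
  using mult_right_mono[OF g heat_kernel_nonneg[of t x]]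
  by (simp add: heat_dom_def abs_mult heat_kernel_nonneg mult_ac)

lemma heat_kernel_le_dom:
  fixes x :: "'a::euclidean_space"
  assumes t: "0 < t"
  shows "\<bar>heat_kernel t x\<bar> \<le> 1 * heat_dom t x"
    and "\<bar>heat_kernel_dt t x\<bar> \<le> (1 + DIM('a)) * heat_dom t x"
    and "\<bar>heat_kernel_dx e t x\<bar> \<le> norm e * heat_dom t x"
    and "\<bar>heat_kernel_dxx e h t x\<bar> \<le> norm e * norm h * heat_dom t x"
proof -
  define n where "n = norm x"
  define s where "s = 1 / t"
  have s: "0 < s" "0 \<le> n" using t by (auto simp: s_def n_def)
  have 1: "1 \<le> (1 + n\<^sup>2) * (1 + s)\<^sup>2"
    using mult_mono[of 1 "1 + n\<^sup>2" 1 "(1 + s)\<^sup>2"] s by (simp add: power2_eq_square algebra_simps)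
  have 2: "n\<^sup>2 * s\<^sup>2 + s \<le> (1 + n\<^sup>2) * (1 + s)\<^sup>2"
    using s by (simp add: power2_eq_square algebra_simps add_increasing)
  have "n * s \<le> (1 + n\<^sup>2) * (1 + s)\<^sup>2"
    using s by (intro mult_mono le_1_plus_square) (auto simp: power2_eq_square algebra_simps)
  note 3 = this
  from heat_dom_ge[of 1 1 x] 1 show "\<bar>heat_kernel t x\<bar> \<le> 1 * heat_dom t x"
    by (simp add: n_def s_def)
  have "\<bar>n\<^sup>2 / (4 * t\<^sup>2) - DIM('a) / (2 * t)\<bar> \<le> n\<^sup>2 / (4 * t\<^sup>2) + DIM('a) / (2 * t)"
    using t abs_triangle_ineq4[of "n\<^sup>2 / (4 * t\<^sup>2)" "DIM('a) / (2 * t)"] by simp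
  also have "\<dots> = n\<^sup>2 * s\<^sup>2 / 4 + DIM('a) * s / 2" by (simp add: s_def power_one_over)
  also have "\<dots> \<le> (1 + DIM('a)) * (n\<^sup>2 * s\<^sup>2 + s)"
  proof -
    have "0 \<le> DIM('a) * (n\<^sup>2 * s\<^sup>2)" "0 \<le> DIM('a) * s" "0 \<le> n\<^sup>2 * s\<^sup>2" using s by auto
    moreover have "(1 + DIM('a)) * (n\<^sup>2 * s\<^sup>2 + s) = n\<^sup>2 * s\<^sup>2 + s + DIM('a) * (n\<^sup>2 * s\<^sup>2) + DIM('a) * s"
      by (simp add: algebra_simps)
    ultimately show ?thesis using s by linarith
  qed
  also have "\<dots> \<le> (1 + DIM('a)) * ((1 + n\<^sup>2) * (1 + s)\<^sup>2)" using 2 by (intro mult_left_mono) auto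
  finally show "\<bar>heat_kernel_dt t x\<bar> \<le> (1 + DIM('a)) * heat_dom t x"
    unfolding heat_kernel_dt_def n_def s_def by (intro heat_dom_ge) auto
  have i: "\<bar>x \<bullet> e\<bar> \<le> norm e * n" for e
    using Cauchy_Schwarz_ineq2[of x e] by (simp add: n_def mult.commute)
  have "\<bar>- (x \<bullet> e) / (2 * t)\<bar> = \<bar>x \<bullet> e\<bar> * s / 2" using t by (simp add: s_def abs_mult)
  also have "\<dots> \<le> norm e * n * s / 2"
    using i[of e] s by (intro divide_right_mono mult_right_mono) auto
  also have "\<dots> \<le> norm e * (n * s)" using s by simp
  also have "\<dots> \<le> norm e * ((1 + n\<^sup>2) * (1 + s)\<^sup>2)" using 3 by (intro mult_left_mono) auto
  finally show "\<bar>heat_kernel_dx e t x\<bar> \<le> norm e * heat_dom t x"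
    unfolding heat_kernel_dx_def n_def s_def by (intro heat_dom_ge) auto
  have "\<bar>(x \<bullet> e) * (x \<bullet> h) / (4 * t\<^sup>2) - (e \<bullet> h) / (2 * t)\<bar>
      \<le> \<bar>(x \<bullet> e) * (x \<bullet> h) / (4 * t\<^sup>2)\<bar> + \<bar>(e \<bullet> h) / (2 * t)\<bar>" by (rule abs_triangle_ineq4)
  also have "\<dots> = \<bar>x \<bullet> e\<bar> * \<bar>x \<bullet> h\<bar> * s\<^sup>2 / 4 + \<bar>e \<bullet> h\<bar> * s / 2"
    using t by (simp add: s_def abs_mult power_one_over)
  also have "\<dots> \<le> (norm e * n) * (norm h * n) * s\<^sup>2 / 4 + (norm e * norm h) * s / 2"
    using s i[of e] i[of h] Cauchy_Schwarz_ineq2[of e h]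
    by (intro add_mono divide_right_mono mult_right_mono mult_mono) auto
  also have "\<dots> \<le> norm e * norm h * (n\<^sup>2 * s\<^sup>2 + s)"
  proof -
    have "0 \<le> norm e * norm h * (n\<^sup>2 * s\<^sup>2)" "0 \<le> norm e * norm h * s" using s by auto
    moreover have "(norm e * n) * (norm h * n) * s\<^sup>2 / 4 = norm e * norm h * (n\<^sup>2 * s\<^sup>2) / 4"
      by (simp add: power2_eq_square)
    ultimately show ?thesis unfolding distrib_left by linarith
  qed
  also have "\<dots> \<le> norm e * norm h * ((1 + n\<^sup>2) * (1 + s)\<^sup>2)" using 2 by (intro mult_left_mono) auto
  finally show "\<bar>heat_kernel_dxx e h t x\<bar> \<le> norm e * norm h * heat_dom t x"
    unfolding heat_kernel_dxx_def n_def s_def by (intro heat_dom_ge) auto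
qed

text \<open>
  A Gaussian bound in \<open>y\<close> that is uniform for \<open>(t, x)\<close> in a compact subset of the open half space. Half of
  the exponent absorbs the polynomial factor, and \<open>(norm y)\<^sup>2 \<le> 2 (norm (x - y))\<^sup>2 + 2 (norm x)\<^sup>2\<close>
  recentres the rest at the origin.
\<close>
lemma heat_dom_gaussian_bound:
  fixes a b r :: real
  assumes ab: "0 < a" "a \<le> b"
  obtains C c where "0 \<le> C" "0 < c"
    "\<And>t x y::'a::euclidean_space. t \<in> {a..b} \<Longrightarrow> norm x \<le> r \<Longrightarrow> heat_dom t (x - y) \<le> C * exp (- c * (norm y)\<^sup>2)"
proof
  define k where "k = real DIM('a) / 2"
  define c where "c = 1 / (8 * b)"
  define C where "C = (1 + 8 * b) * (1 + 1 / a)\<^sup>2 * (4 * pi * a) powr (- k) * exp (c * r\<^sup>2)"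
  show "0 \<le> C" "0 < c / 2" using ab by (simp_all add: C_def c_def)
  fix t :: real and x y :: 'a
  assume t: "t \<in> {a..b}" and x: "norm x \<le> r"
  define n where "n = (norm (x - y))\<^sup>2"
  have c: "0 < c" using ab by (simp add: c_def)
  have n: "0 \<le> n" by (simp add: n_def)
  have "n / (4 * b) \<le> n / (4 * t)" using t ab n by (intro divide_left_mono) auto
  then have "(1 + n) * exp (- n / (4 * t)) \<le> (1 + n) * exp (- (2 * c * n))"
    using n by (intro mult_left_mono) (auto simp: c_def)
  also have "\<dots> \<le> (1 + 8 * b) * exp (c * n) * exp (- (2 * c * n))"
  proof (intro mult_right_mono)
    have "n = 8 * b * (c * n)" using ab by (simp add: c_def)
    also have "c * n \<le> exp (c * n)" using exp_ge_add_one_self[of "c * n"] by linarith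
    finally have "n \<le> 8 * b * exp (c * n)" using ab by simp
    moreover have "1 \<le> exp (c * n)" using c n by simp
    ultimately show "1 + n \<le> (1 + 8 * b) * exp (c * n)" unfolding distrib_right by linarith
  qed simp
  also have "\<dots> = (1 + 8 * b) * exp (- (c * n))" by (simp add: exp_add[symmetric])
  also have "\<dots> \<le> (1 + 8 * b) * (exp (c * r\<^sup>2) * exp (- (c / 2) * (norm y)\<^sup>2))"
  proof (intro mult_left_mono)
    have "norm y \<le> norm (x - y) + norm x" by (metis norm_minus_commute norm_triangle_sub add.commute)
    then have "(norm y)\<^sup>2 \<le> (norm (x - y) + norm x)\<^sup>2" by (intro power_mono) auto
    also have "\<dots> \<le> 2 * n + 2 * (norm x)\<^sup>2"
      using zero_le_power2[of "norm (x - y) - norm x"] by (simp add: n_def power2_eq_square algebra_simps)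
    also have "(norm x)\<^sup>2 \<le> r\<^sup>2" using x by (intro power_mono) auto
    finally have "c / 2 * (norm y)\<^sup>2 \<le> c / 2 * (2 * n + 2 * r\<^sup>2)" using c by (intro mult_left_mono) auto
    then show "exp (- (c * n)) \<le> exp (c * r\<^sup>2) * exp (- (c / 2) * (norm y)\<^sup>2)"
      unfolding exp_add[symmetric] by (simp add: algebra_simps)
  qed (use ab in auto)
  finally have 1: "(1 + n) * exp (- n / (4 * t)) \<le> (1 + 8 * b) * (exp (c * r\<^sup>2) * exp (- (c / 2) * (norm y)\<^sup>2))" .
  have 2: "(1 + 1 / t)\<^sup>2 * (4 * pi * t) powr (- k) \<le> (1 + 1 / a)\<^sup>2 * (4 * pi * a) powr (- k)"
    using t ab by (intro mult_mono power_mono powr_mono2') (auto simp: k_def frac_le)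
  have "heat_dom t (x - y) = ((1 + n) * exp (- n / (4 * t))) * ((1 + 1 / t)\<^sup>2 * (4 * pi * t) powr (- k))"
    by (simp add: heat_dom_def heat_kernel_def n_def k_def)
  also have "\<dots> \<le> ((1 + 8 * b) * (exp (c * r\<^sup>2) * exp (- (c / 2) * (norm y)\<^sup>2))) *
      ((1 + 1 / a)\<^sup>2 * (4 * pi * a) powr (- k))"
    using ab n by (intro mult_mono[OF 1 2]) auto
  also have "\<dots> = C * exp (- (c / 2) * (norm y)\<^sup>2)" by (simp add: C_def mult_ac)
  finally show "heat_dom t (x - y) \<le> C * exp (- (c / 2) * (norm y)\<^sup>2)" .
qed

section \<open>Smoothing by the heat kernel\<close>

definition heat_conv :: "('a \<Rightarrow> real) \<Rightarrow> (real \<Rightarrow> 'a \<Rightarrow> real) \<Rightarrow> real \<Rightarrow> 'a::euclidean_space \<Rightarrow> real" where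
  "heat_conv f g t x = (\<integral>y. f y * g t (x - y) \<partial>lborel)"

text \<open>
  The growth condition under which every convolution with the heat kernel or with one of its
  derivatives converges absolutely, with an integrable majorant that is locally uniform in \<open>(t, x)\<close>.
\<close>
definition gauss_integrable :: "('a::euclidean_space \<Rightarrow> real) \<Rightarrow> bool" where
  "gauss_integrable f \<longleftrightarrow> f \<in> borel_measurable borel \<and>
     (\<forall>c>0. integrable lborel (\<lambda>y. f y * exp (- c * (norm y)\<^sup>2)))"

lemma gauss_integrableD:
  assumes "gauss_integrable f"
  shows "f \<in> borel_measurable borel"
    "0 < c \<Longrightarrow> integrable lborel (\<lambda>y. \<bar>f y\<bar> * (C * exp (- c * (norm y)\<^sup>2)))"
proof -
  show "f \<in> borel_measurable borel" using assms by (simp add: gauss_integrable_def)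
  assume "0 < c"
  then have "integrable lborel (\<lambda>y. C * \<bar>f y * exp (- c * (norm y)\<^sup>2)\<bar>)"
    using assms unfolding gauss_integrable_def by (intro integrable_mult_right integrable_abs) auto
  then show "integrable lborel (\<lambda>y. \<bar>f y\<bar> * (C * exp (- c * (norm y)\<^sup>2)))"
    by (simp add: abs_mult mult_ac)
qed

lemma gauss_integrable_conv:
  fixes f :: "'a::euclidean_space \<Rightarrow> real"
  assumes f: "gauss_integrable f" and t: "0 < t"
    and g: "g t \<in> borel_measurable borel" "\<And>x. \<bar>g t x\<bar> \<le> A * heat_dom t x" and A: "0 \<le> A"
  shows "integrable lborel (\<lambda>y. f y * g t (x - y))"
proof -
  obtain C c where C: "0 \<le> C" "0 < c"
    "\<And>s z y::'a. s \<in> {t..t} \<Longrightarrow> norm z \<le> norm x \<Longrightarrow> heat_dom s (z - y) \<le> C * exp (- c * (norm y)\<^sup>2)"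
    using heat_dom_gaussian_bound[OF t order_refl, where r = "norm x"] by blast
  note [measurable] = gauss_integrableD(1)[OF f] g(1)
  show ?thesis
  proof (rule Bochner_Integration.integrable_bound[OF gauss_integrableD(2)[OF f C(2), of "A * C"]])
    have "\<bar>g t (x - y)\<bar> \<le> A * (C * exp (- c * (norm y)\<^sup>2))" for y
      using order_trans[OF g(2) mult_left_mono[OF C(3) A]] by simp
    from mult_left_mono[OF this abs_ge_zero]
    have "\<bar>f y\<bar> * \<bar>g t (x - y)\<bar> \<le> \<bar>f y\<bar> * (A * (C * exp (- c * (norm y)\<^sup>2)))" for y .
    then show "AE y in lborel. norm (f y * g t (x - y)) \<le> norm (\<bar>f y\<bar> * (A * C * exp (- c * (norm y)\<^sup>2)))"
      using A C(1) by (intro AE_I2) (simp add: abs_mult mult.assoc)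
  qed measurable
qed

lemma heat_conv_continuous:
  fixes f :: "'a::euclidean_space \<Rightarrow> real"
  assumes f: "gauss_integrable f" and A: "0 \<le> A"
    and meas: "\<And>t. g t \<in> borel_measurable borel"
    and cont: "continuous_on ({0<..} \<times> UNIV) (\<lambda>(t, x). g t x)"
    and bound: "\<And>t x. 0 < t \<Longrightarrow> \<bar>g t x\<bar> \<le> A * heat_dom t x"
  shows "continuous_on ({0<..} \<times> UNIV) (\<lambda>(t, x). heat_conv f g t x)"
proof (intro continuous_at_imp_continuous_on ballI)
  fix z0 :: "real \<times> 'a" assume "z0 \<in> {0<..} \<times> UNIV"
  then obtain t0 x0 where z0: "z0 = (t0, x0)" and t0: "0 < t0" by auto
  obtain C c where C: "0 \<le> C" "0 < c"
    "\<And>t x y::'a. t \<in> {t0/2..2*t0} \<Longrightarrow> norm x \<le> norm x0 + 1 \<Longrightarrow> heat_dom t (x - y) \<le> C * exp (- c * (norm y)\<^sup>2)"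
  proof -
    have "0 < t0/2" "t0/2 \<le> 2*t0" using t0 by auto
    from heat_dom_gaussian_bound[OF this, where r = "norm x0 + 1"] that show thesis by blast
  qed
  note [measurable] = gauss_integrableD(1)[OF f] meas
  show "isCont (\<lambda>(t, x). heat_conv f g t x) z0"
    unfolding heat_conv_def split_def
  proof (rule isCont_integral_dominated[OF _ gauss_integrableD(2)[OF f C(2), of "A * C"]])
    fix y :: 'a
    have "continuous_on ({0<..} \<times> UNIV) (\<lambda>z. (\<lambda>(t, x). g t x) (fst z, snd z - y))"
      by (rule continuous_on_compose2[OF cont]) (auto intro!: continuous_intros)
    then have "isCont (\<lambda>z. (\<lambda>(t, x). g t x) (fst z, snd z - y)) z0"
      using t0 z0 by (subst (asm) continuous_on_eq_continuous_at) (auto intro: open_Times)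
    then show "isCont (\<lambda>z. f y * g (fst z) (snd z - y)) z0"
      by (intro continuous_intros) auto
  next
    have "\<forall>\<^sub>F z in nhds z0. fst z \<in> {t0/2<..<2*t0} \<and> snd z \<in> ball x0 1"
      using t0 z0 eventually_nhds_in_open[of "{t0/2<..<2*t0} \<times> ball x0 1" z0]
      by (auto simp: open_Times mem_Times_iff)
    then show "\<forall>\<^sub>F z in nhds z0. \<forall>y\<in>space lborel. \<bar>f y * g (fst z) (snd z - y)\<bar> \<le> \<bar>f y\<bar> * (A * C * exp (- c * (norm y)\<^sup>2))"
    proof eventually_elim
      case (elim z)
      have "norm (snd z) \<le> norm x0 + 1"
        using elim norm_triangle_ineq2[of "snd z" x0] by (auto simp: dist_norm norm_minus_commute)
      then have "\<bar>g (fst z) (snd z - y)\<bar> \<le> A * (C * exp (- c * (norm y)\<^sup>2))" for y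
        using elim t0 by (intro order_trans[OF bound mult_left_mono[OF C(3) A]]) auto
      from mult_left_mono[OF this abs_ge_zero] show ?case by (simp add: abs_mult mult.assoc)
    qed
  qed measurable
qed

lemma heat_conv_has_derivative_x:
  fixes f :: "'a::euclidean_space \<Rightarrow> real"
  assumes f: "gauss_integrable f" and A: "0 \<le> A" "0 \<le> B" and t: "0 < t"
    and meas: "g t \<in> borel_measurable borel" "\<And>h. g' h t \<in> borel_measurable borel"
    and deriv: "\<And>x. (g t has_derivative (\<lambda>h. g' h t x)) (at x)"
    and bound: "\<And>x. \<bar>g t x\<bar> \<le> A * heat_dom t x"
    and bound': "\<And>h x. \<bar>g' h t x\<bar> \<le> B * norm h * heat_dom t x"
  shows "(heat_conv f g t has_derivative (\<lambda>h. heat_conv f (g' h) t x)) (at x)"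
proof -
  obtain C c where C: "0 \<le> C" "0 < c"
    "\<And>s z y::'a. s \<in> {t..t} \<Longrightarrow> norm z \<le> norm x + 1 \<Longrightarrow> heat_dom s (z - y) \<le> C * exp (- c * (norm y)\<^sup>2)"
    using heat_dom_gaussian_bound[OF t order_refl, where r = "norm x + 1"] by blast
  note [measurable] = gauss_integrableD(1)[OF f] meas
  show ?thesis
    unfolding heat_conv_def[abs_def]
  proof (rule has_derivative_integral_dominated[OF _ _ gauss_integrableD(2)[OF f C(2), of "B * C"], where r = 1
        and K' = "\<lambda>x y h. f y * g' h t (x - y)"])
    show "integrable lborel (\<lambda>y. f y * g t (z - y))" for z
      by (rule gauss_integrable_conv[where g = g and A = A, OF f t meas(1) bound A(1)])
    fix z y :: 'a
    have "((\<lambda>z. g t (z - y)) has_derivative (\<lambda>h. g' h t (z - y))) (at z)"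
      using has_derivative_compose[OF has_derivative_diff[OF has_derivative_ident has_derivative_const] deriv, of y z UNIV]
      by simp
    then show "((\<lambda>z. f y * g t (z - y)) has_derivative (\<lambda>h. f y * g' h t (z - y))) (at z)"
      by (rule has_derivative_mult_right)
    assume z: "z \<in> ball x 1"
    fix h :: 'a
    have "norm z \<le> norm x + 1"
      using z norm_triangle_ineq2[of z x] by (auto simp: dist_norm norm_minus_commute)
    then have "\<bar>g' h t (z - y)\<bar> \<le> B * norm h * (C * exp (- c * (norm y)\<^sup>2))"
      using A by (intro order_trans[OF bound' mult_left_mono[OF C(3)]]) auto
    from mult_left_mono[OF this abs_ge_zero[of "f y"]]
    show "\<bar>f y * g' h t (z - y)\<bar> \<le> \<bar>f y\<bar> * (B * C * exp (- c * (norm y)\<^sup>2)) * norm h"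
      by (simp add: abs_mult mult_ac)
  qed auto
qed

lemma heat_conv_has_derivative_t:
  fixes f :: "'a::euclidean_space \<Rightarrow> real"
  assumes f: "gauss_integrable f" and t: "0 < t"
  shows "((\<lambda>t. heat_conv f heat_kernel t x) has_real_derivative heat_conv f heat_kernel_dt t x) (at t)"
proof -
  obtain C c where C: "0 \<le> C" "0 < c"
    "\<And>s z y::'a. s \<in> {t/2..2*t} \<Longrightarrow> norm z \<le> norm x \<Longrightarrow> heat_dom s (z - y) \<le> C * exp (- c * (norm y)\<^sup>2)"
  proof -
    have "0 < t/2" "t/2 \<le> 2*t" using t by auto
    from heat_dom_gaussian_bound[OF this, where r = "norm x"] that show thesis by blast
  qed
  note [measurable] = gauss_integrableD(1)[OF f]
  show ?thesis
    unfolding heat_conv_def[abs_def]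
  proof (rule DERIV_integral_dominated[OF _ _ gauss_integrableD(2)[OF f C(2), of "(1 + DIM('a)) * C"], where r = "t/2"])
    fix s assume "s \<in> ball t (t/2)"
    then have s: "0 < s" "s \<in> {t/2..2*t}" using t unfolding mem_ball dist_real_def atLeastAtMost_iff by linarith+
    show "integrable lborel (\<lambda>y. f y * heat_kernel s (x - y))"
      using gauss_integrable_conv[where g = heat_kernel and A = 1, OF f s(1) _ heat_kernel_le_dom(1)[OF s(1)]]
      by simp
    fix y
    show "((\<lambda>s. f y * heat_kernel s (x - y)) has_real_derivative f y * heat_kernel_dt s (x - y)) (at s)"
      by (intro DERIV_cmult heat_kernel_has_derivative_t s)
    have "\<bar>heat_kernel_dt s (x - y)\<bar> \<le> (1 + DIM('a)) * (C * exp (- c * (norm y)\<^sup>2))"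
      using s by (intro order_trans[OF heat_kernel_le_dom(2) mult_left_mono[OF C(3)]]) auto
    from mult_left_mono[OF this abs_ge_zero[of "f y"]]
    show "\<bar>f y * heat_kernel_dt s (x - y)\<bar> \<le> \<bar>f y\<bar> * ((1 + DIM('a)) * C * exp (- c * (norm y)\<^sup>2))"
      by (simp add: abs_mult mult_ac)
  qed (use t in auto)
qed

lemma heat_conv_derivs:
  fixes f :: "'a::euclidean_space \<Rightarrow> real"
  assumes f: "gauss_integrable f" and t: "0 < t"
  shows "(heat_conv f heat_kernel t has_derivative (\<lambda>h. heat_conv f (heat_kernel_dx h) t x)) (at x)"
    and "(heat_conv f (heat_kernel_dx e) t has_derivative (\<lambda>h. heat_conv f (heat_kernel_dxx e h) t x)) (at x)"
proof -
  show "(heat_conv f heat_kernel t has_derivative (\<lambda>h. heat_conv f (heat_kernel_dx h) t x)) (at x)"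
  proof (rule heat_conv_has_derivative_x[OF f, where A = 1 and B = 1])
    show "\<bar>heat_kernel_dx h t x\<bar> \<le> 1 * norm h * heat_dom t x" for h x :: 'a
      using heat_kernel_le_dom(3)[OF t, of h x] by simp
    show "\<bar>heat_kernel t x\<bar> \<le> 1 * heat_dom t x" for x :: 'a
      by (rule heat_kernel_le_dom(1)[OF t])
  qed (use t in \<open>auto intro: heat_kernel_has_derivative_x\<close>)
  show "(heat_conv f (heat_kernel_dx e) t has_derivative (\<lambda>h. heat_conv f (heat_kernel_dxx e h) t x)) (at x)"
    by (rule heat_conv_has_derivative_x[where g = "heat_kernel_dx e" and g' = "heat_kernel_dxx e",
          OF f _ _ t _ _ heat_kernel_dx_has_derivative[OF t]
          heat_kernel_le_dom(3)[OF t] heat_kernel_le_dom(4)[OF t]]) auto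
qed

lemma heat_conv_continuous_kernels:
  fixes f :: "'a::euclidean_space \<Rightarrow> real"
  assumes f: "gauss_integrable f"
  shows "continuous_on ({0<..} \<times> UNIV) (\<lambda>(t, x). heat_conv f heat_kernel t x)"
    and "continuous_on ({0<..} \<times> UNIV) (\<lambda>(t, x). heat_conv f heat_kernel_dt t x)"
    and "continuous_on ({0<..} \<times> UNIV) (\<lambda>(t, x). heat_conv f (heat_kernel_dx e) t x)"
    and "continuous_on ({0<..} \<times> UNIV) (\<lambda>(t, x). heat_conv f (heat_kernel_dxx e h) t x)"
proof -
  show "continuous_on ({0<..} \<times> UNIV) (\<lambda>(t, x). heat_conv f heat_kernel t x)"
    by (rule heat_conv_continuous[OF f _ _ heat_kernel_continuous(1) heat_kernel_le_dom(1)]) auto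
  show "continuous_on ({0<..} \<times> UNIV) (\<lambda>(t, x). heat_conv f heat_kernel_dt t x)"
    by (rule heat_conv_continuous[OF f _ _ heat_kernel_continuous(2) heat_kernel_le_dom(2)]) auto
  show "continuous_on ({0<..} \<times> UNIV) (\<lambda>(t, x). heat_conv f (heat_kernel_dx e) t x)"
    by (rule heat_conv_continuous[OF f _ _ heat_kernel_continuous(3) heat_kernel_le_dom(3)]) auto
  show "continuous_on ({0<..} \<times> UNIV) (\<lambda>(t, x). heat_conv f (heat_kernel_dxx e h) t x)"
    by (rule heat_conv_continuous[OF f _ _ heat_kernel_continuous(4) heat_kernel_le_dom(4)]) auto
qed

lemma heat_equation:
  fixes f :: "'a::euclidean_space \<Rightarrow> real"
  assumes f: "gauss_integrable f" and t: "0 < t"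
  shows "heat_conv f heat_kernel_dt t x = (\<Sum>e\<in>Basis. heat_conv f (heat_kernel_dxx e e) t x)"
proof -
  have "integrable lborel (\<lambda>y. f y * heat_kernel_dxx e e t (x - y))" for e :: 'a
    using gauss_integrable_conv[where g = "heat_kernel_dxx e e" and A = "norm e * norm e", OF f t _ heat_kernel_le_dom(4)[OF t]]
    by simp
  then show ?thesis
    unfolding heat_conv_def heat_equation_kernel sum_distrib_left by (intro Bochner_Integration.integral_sum) auto
qed

lemma gauss_semigroup_eq_heat_conv:
  fixes f :: "'a::euclidean_space \<Rightarrow> real"
  assumes [measurable]: "f \<in> borel_measurable borel"
  shows "gauss_semigroup t f = heat_conv f heat_kernel t"
  unfolding gauss_semigroup_def[abs_def] heat_conv_def[abs_def]
  by (intro ext integral_completion) measurable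

text \<open>
  The Frechet derivative is \<open>h \<mapsto> heat_conv f (heat_kernel_dx h) t x\<close>. Its linearity in \<open>h\<close>, which comes
  with differentiability, identifies the gradient through its coordinates.
\<close>
lemma norm_gradient_gauss_semigroup:
  fixes f :: "'a::euclidean_space \<Rightarrow> real"
  assumes f: "gauss_integrable f" and t: "0 < t"
  shows "(norm (gradient (gauss_semigroup t f) x))\<^sup>2 = (\<Sum>e\<in>Basis. (heat_conv f (heat_kernel_dx e) t x)\<^sup>2)"
proof -
  let ?L = "\<lambda>h. heat_conv f (heat_kernel_dx h) t x"
  define D where "D = (\<Sum>e\<in>Basis. ?L e *\<^sub>R e)"
  have d: "(heat_conv f heat_kernel t has_derivative ?L) (at x)"
    by (rule heat_conv_derivs[OF f t])
  then have "linear ?L" using has_derivative_linear by blast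
  then have L: "?L h = h \<bullet> D" for h
    using Linear_Algebra.linear_componentwise[of ?L h 1] by (simp add: D_def inner_sum_right mult.commute)
  then have G: "GDERIV (gauss_semigroup t f) x :> D"
    using d by (simp add: gderiv_def gauss_semigroup_eq_heat_conv[OF gauss_integrableD(1)[OF f]])
  have "D' = D" if "GDERIV (gauss_semigroup t f) x :> D'" for D'
    using has_derivative_unique[OF G[unfolded gderiv_def] that[unfolded gderiv_def]]
    by (metis inner_commute vector_eq_ldot)
  from the_equality[where P = "\<lambda>D. GDERIV (gauss_semigroup t f) x :> D", OF G this]
  have "gradient (gauss_semigroup t f) x = D"
    unfolding gradient_def .
  then have "(norm (gradient (gauss_semigroup t f) x))\<^sup>2 = D \<bullet> D"
    by (simp add: power2_norm_eq_inner)
  also have "\<dots> = (\<Sum>e\<in>Basis. (D \<bullet> e) * (D \<bullet> e))" by (rule euclidean_inner)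
  finally show ?thesis by (simp add: L inner_commute power2_eq_square)
qed

section \<open>The heat kernel as a probability density\<close>

lemma heat_kernel_prod_normal:
  fixes x :: "'a::euclidean_space"
  assumes "0 < t"
  shows "heat_kernel t x = (\<Prod>b\<in>Basis. normal_density 0 (sqrt (2 * t)) (x \<bullet> b))"
proof -
  have "(\<Prod>b\<in>Basis. normal_density 0 (sqrt (2 * t)) (x \<bullet> b)) =
      (\<Prod>b\<in>(Basis::'a set). (4 * pi * t) powr (- 1 / 2) * exp (- (x \<bullet> b)\<^sup>2 / (4 * t)))"
    using assms by (intro prod.cong refl)
      (simp add: normal_density_def powr_minus_divide powr_half_sqrt mult_ac)
  also have "\<dots> = ((4 * pi * t) powr (- 1 / 2)) ^ DIM('a) * exp (\<Sum>b\<in>Basis. - (x \<bullet> b)\<^sup>2 / (4 * t))"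
    by (simp add: prod.distrib exp_sum)
  also have "((4 * pi * t) powr (- 1 / 2)) ^ DIM('a) = (4 * pi * t) powr (- real DIM('a) / 2)"
    using assms by (subst powr_power) auto
  also have "(\<Sum>b\<in>Basis. - (x \<bullet> b)\<^sup>2 / (4 * t)) = - (norm x)\<^sup>2 / (4 * t)"
  proof -
    have "(norm x)\<^sup>2 = (\<Sum>b\<in>Basis. (x \<bullet> b)\<^sup>2)"
      unfolding power2_norm_eq_inner by (subst euclidean_inner) (simp add: power2_eq_square)
    then show ?thesis by (simp add: sum_negf sum_divide_distrib)
  qed
  finally show ?thesis by (simp add: heat_kernel_def)
qed

lemma nn_integral_heat_kernel:
  assumes "0 < t"
  shows "(\<integral>\<^sup>+(x::'a::euclidean_space). ennreal (heat_kernel t x) \<partial>lborel) = 1"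
proof -
  have "(\<integral>\<^sup>+x. ennreal (normal_density 0 (sqrt (2 * t)) x) \<partial>lborel) = 1"
    using assms by (subst nn_integral_eq_integral) auto
  then have "(\<integral>\<^sup>+(x::'a). (\<Prod>b\<in>Basis. ennreal (normal_density 0 (sqrt (2 * t)) (x \<bullet> b))) \<partial>lborel) = 1"
    by (subst nn_integral_lborel_prod) auto
  then show ?thesis
    using assms by (simp add: heat_kernel_prod_normal prod_ennreal)
qed

lemma nn_integral_lborel_affine:
  fixes F :: "'a::euclidean_space \<Rightarrow> ennreal" and c :: real
  assumes [measurable]: "F \<in> borel_measurable borel" and "c \<noteq> 0"
  shows "(\<integral>\<^sup>+y. F y \<partial>lborel) = ennreal (\<bar>c\<bar> ^ DIM('a)) * (\<integral>\<^sup>+y. F (x + c *\<^sub>R y) \<partial>lborel)"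
  using assms(2) by (subst lborel_affine[of c x])
    (auto simp: nn_integral_density nn_integral_distr nn_integral_cmult ennreal_power)

lemma integral_lborel_affine:
  fixes F :: "'a::euclidean_space \<Rightarrow> real" and c :: real
  assumes [measurable]: "F \<in> borel_measurable borel" and "c \<noteq> 0"
  shows "(\<integral>y. F y \<partial>lborel) = \<bar>c\<bar> ^ DIM('a) * (\<integral>y. F (x + c *\<^sub>R y) \<partial>lborel)"
  using assms(2) by (subst lborel_affine[of c x])
    (auto simp: integral_density integral_distr)

lemma nn_integral_heat_kernel_shift:
  fixes x :: "'a::euclidean_space"
  assumes "0 < t"
  shows "(\<integral>\<^sup>+y. ennreal (heat_kernel t (x - y)) \<partial>lborel) = 1"
    and "(\<integral>\<^sup>+y. ennreal (heat_kernel t (y - x)) \<partial>lborel) = 1"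
proof -
  show "(\<integral>\<^sup>+y. ennreal (heat_kernel t (x - y)) \<partial>lborel) = 1"
    using nn_integral_lborel_affine[of "\<lambda>y. ennreal (heat_kernel t y)" "-1" x] nn_integral_heat_kernel[OF assms, where 'a = 'a]
    by simp
  show "(\<integral>\<^sup>+y. ennreal (heat_kernel t (y - x)) \<partial>lborel) = 1"
    using nn_integral_lborel_affine[of "\<lambda>y. ennreal (heat_kernel t y)" "1" "-x"] nn_integral_heat_kernel[OF assms, where 'a = 'a]
    by simp
qed

lemma integrable_heat_kernel_shift:
  assumes "0 < t"
  shows "integrable lborel (\<lambda>y::'a::euclidean_space. heat_kernel t (x - y))"
  using nn_integral_heat_kernel_shift(1)[OF assms, of x]
  by (intro integrableI_nonneg) (auto simp: heat_kernel_nonneg)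

lemma integrable_gaussian:
  assumes "0 < c"
  shows "integrable lborel (\<lambda>y::'a::euclidean_space. exp (- c * (norm y)\<^sup>2))"
proof -
  define t where "t = 1 / (4 * c)"
  have t: "0 < t" using assms by (simp add: t_def)
  have "integrable lborel (\<lambda>y::'a. (4 * pi * t) powr (real DIM('a) / 2) * heat_kernel t (0 - y))"
    by (intro integrable_mult_right integrable_heat_kernel_shift t)
  moreover have "(4 * pi * t) powr (real DIM('a) / 2) * heat_kernel t (0 - y) = exp (- c * (norm y)\<^sup>2)" for y :: 'a
    using t assms by (simp add: heat_kernel_def powr_add[symmetric] mult.assoc[symmetric])
      (simp add: t_def)
  ultimately show ?thesis by (simp only:)
qed

lemma heat_kernel_le:
  fixes x :: "'a::euclidean_space"
  assumes "0 < t"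
  shows "heat_kernel t x \<le> (4 * pi * t) powr (- real DIM('a) / 2)"
  using assms by (simp add: heat_kernel_def mult_left_le)

section \<open>The heat semigroup on \<open>L\<^sup>p\<close>\<close>

definition Lp_norm_powr :: "real \<Rightarrow> ('a::euclidean_space \<Rightarrow> real) \<Rightarrow> ennreal" where
  "Lp_norm_powr p f = (\<integral>\<^sup>+x. ennreal (\<bar>f x\<bar> powr p) \<partial>lborel)"

lemma Lp_finite_integrable:
  assumes [measurable]: "f \<in> borel_measurable borel" and "Lp_norm_powr p f < \<infinity>"
  shows "integrable lborel (\<lambda>x. \<bar>f x\<bar> powr p)"
  using assms(2) unfolding Lp_norm_powr_def by (intro integrableI_nonneg) auto

lemma le_1_plus_powr: "1 \<le> p \<Longrightarrow> \<bar>u::real\<bar> \<le> 1 + \<bar>u\<bar> powr p"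
  using powr_mono[of 1 p "\<bar>u\<bar>"] by (cases "\<bar>u\<bar> \<le> 1") (auto intro: order_trans add_increasing2)

text \<open>
  Since \<open>\<bar>f\<bar> \<le> 1 + \<bar>f\<bar> powr p\<close>, integrability against Gaussians needs no Hoelder inequality.
\<close>
lemma Lp_gauss_integrable:
  fixes f :: "'a::euclidean_space \<Rightarrow> real"
  assumes [measurable]: "f \<in> borel_measurable borel" and "Lp_norm_powr p f < \<infinity>" and "1 \<le> p"
  shows "gauss_integrable f"
  unfolding gauss_integrable_def
proof (intro conjI allI impI)
  fix c :: real assume c: "0 < c"
  have "integrable lborel (\<lambda>y. exp (- c * (norm y)\<^sup>2) + \<bar>f y\<bar> powr p)"
    by (intro Bochner_Integration.integrable_add integrable_gaussian c Lp_finite_integrable assms)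
  then show "integrable lborel (\<lambda>y. f y * exp (- c * (norm y)\<^sup>2))"
  proof (rule Bochner_Integration.integrable_bound)
    have "\<bar>f y\<bar> * exp (- c * (norm y)\<^sup>2) \<le> exp (- c * (norm y)\<^sup>2) + \<bar>f y\<bar> powr p" for y
    proof -
      have "\<bar>f y\<bar> * exp (- c * (norm y)\<^sup>2) \<le> (1 + \<bar>f y\<bar> powr p) * exp (- c * (norm y)\<^sup>2)"
        by (intro mult_right_mono le_1_plus_powr assms) auto
      moreover have "\<bar>f y\<bar> powr p * exp (- c * (norm y)\<^sup>2) \<le> \<bar>f y\<bar> powr p * 1"
        using c by (intro mult_left_mono) auto
      ultimately show ?thesis by (simp add: distrib_right)
    qed
    then show "AE y in lborel. norm (f y * exp (- c * (norm y)\<^sup>2)) \<le> norm (exp (- c * (norm y)\<^sup>2) + \<bar>f y\<bar> powr p)"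
      by (simp add: abs_mult)
  qed measurable
qed simp

lemma heat_conv_measurable [measurable]:
  assumes [measurable]: "f \<in> borel_measurable borel" "g t \<in> borel_measurable borel"
  shows "heat_conv f g t \<in> borel_measurable borel"
  unfolding heat_conv_def[abs_def] by measurable

lemma integrable_times_heat_kernel:
  fixes f :: "'a::euclidean_space \<Rightarrow> real"
  assumes "gauss_integrable f" "0 < t"
  shows "integrable lborel (\<lambda>y. f y * heat_kernel t (x - y))"
  using gauss_integrable_conv[where g = heat_kernel and A = 1, OF assms _ heat_kernel_le_dom(1)[OF assms(2)]]
  by simp

text \<open>
  Jensen's inequality for the probability measure with density \<open>y \<mapsto> heat_kernel t (x - y)\<close>.
\<close>
lemma heat_conv_abs_powr_le:
  fixes f :: "'a::euclidean_space \<Rightarrow> real"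
  assumes [measurable]: "f \<in> borel_measurable borel" and fin: "Lp_norm_powr p f < \<infinity>"
    and p: "1 < p" and t: "0 < t"
  shows "ennreal (\<bar>heat_conv f heat_kernel t x\<bar> powr p) \<le> (\<integral>\<^sup>+y. ennreal (\<bar>f y\<bar> powr p) * ennreal (heat_kernel t (x - y)) \<partial>lborel)"
proof -
  have f: "gauss_integrable f" using Lp_gauss_integrable[OF assms(1) fin] p by simp
  define M where "M = density lborel (\<lambda>y. ennreal (heat_kernel t (x - y)))"
  have "emeasure M (space M) = 1"
    using nn_integral_heat_kernel_shift(1)[OF t, of x] by (simp add: M_def emeasure_density)
  then interpret prob_space M by (rule prob_spaceI)
  have intp: "integrable lborel (\<lambda>y. \<bar>f y\<bar> powr p * heat_kernel t (x - y))"
  proof (rule Bochner_Integration.integrable_bound[OF integrable_mult_left[OF Lp_finite_integrable[OF assms(1) fin]]])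
    show "AE y in lborel. norm (\<bar>f y\<bar> powr p * heat_kernel t (x - y)) \<le> norm (\<bar>f y\<bar> powr p * (4 * pi * t) powr (- real DIM('a) / 2))"
      using heat_kernel_le[OF t, where 'a = 'a]
      by (auto simp: abs_mult heat_kernel_nonneg intro!: AE_I2 mult_left_mono)
  qed measurable
  have "\<bar>expectation f\<bar> powr p \<le> expectation (\<lambda>y. \<bar>f y\<bar> powr p)"
  proof (rule jensens_inequality[where I = UNIV])
    show "integrable M f"
      unfolding M_def using integrable_times_heat_kernel[OF f t, of x]
      by (subst integrable_density) (auto simp: heat_kernel_nonneg mult.commute)
    show "integrable M (\<lambda>y. \<bar>f y\<bar> powr p)"
      unfolding M_def using intp
      by (subst integrable_density) (auto simp: heat_kernel_nonneg mult.commute)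
  qed (use convex_abs_powr[OF p] in auto)
  then have "\<bar>heat_conv f heat_kernel t x\<bar> powr p \<le> (\<integral>y. \<bar>f y\<bar> powr p * heat_kernel t (x - y) \<partial>lborel)"
    unfolding M_def heat_conv_def
    by (subst (asm) (1 2) integral_density) (auto simp: heat_kernel_nonneg mult.commute)
  then have "ennreal (\<bar>heat_conv f heat_kernel t x\<bar> powr p) \<le> ennreal (\<integral>y. \<bar>f y\<bar> powr p * heat_kernel t (x - y) \<partial>lborel)"
    by (rule ennreal_leI)
  also have "\<dots> = (\<integral>\<^sup>+y. ennreal (\<bar>f y\<bar> powr p * heat_kernel t (x - y)) \<partial>lborel)"
    by (rule nn_integral_eq_integral[symmetric, OF intp]) (simp add: heat_kernel_nonneg)
  finally show ?thesis by (simp add: ennreal_mult heat_kernel_nonneg)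
qed

lemma heat_contraction:
  fixes f :: "'a::euclidean_space \<Rightarrow> real"
  assumes [measurable]: "f \<in> borel_measurable borel" and fin: "Lp_norm_powr p f < \<infinity>"
    and p: "1 < p" and t: "0 < t"
  shows "Lp_norm_powr p (heat_conv f heat_kernel t) \<le> Lp_norm_powr p f"
proof -
  have [measurable]: "(\<lambda>(x::'a, y). heat_kernel t (x - y)) \<in> borel_measurable (borel \<Otimes>\<^sub>M borel)"
    unfolding heat_kernel_def by measurable
  have "Lp_norm_powr p (heat_conv f heat_kernel t)
      \<le> (\<integral>\<^sup>+x. (\<integral>\<^sup>+y. ennreal (\<bar>f y\<bar> powr p) * ennreal (heat_kernel t (x - y)) \<partial>lborel) \<partial>lborel)"
    unfolding Lp_norm_powr_def by (intro nn_integral_mono heat_conv_abs_powr_le assms)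
  also have "\<dots> = (\<integral>\<^sup>+y. (\<integral>\<^sup>+x. ennreal (\<bar>f y\<bar> powr p) * ennreal (heat_kernel t (x - y)) \<partial>lborel) \<partial>lborel)"
    by (rule lborel_pair.Fubini'[symmetric]) measurable
  also have "\<dots> = Lp_norm_powr p f"
    by (simp add: nn_integral_cmult Lp_norm_powr_def nn_integral_heat_kernel_shift(2)[OF t])
  finally show ?thesis .
qed

section \<open>Density of compactly supported continuous functions in \<open>L\<^sup>p\<close>\<close>

lemma Lp_norm_powr_add_le:
  fixes f g :: "'a::euclidean_space \<Rightarrow> real"
  assumes [measurable]: "f \<in> borel_measurable borel" "g \<in> borel_measurable borel"
    and "1 < p" "0 < l" "l < 1"
  shows "Lp_norm_powr p (\<lambda>x. f x + g x) \<le> ennreal ((1 - l) powr (1 - p)) * Lp_norm_powr p f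
    + ennreal (l powr (1 - p)) * Lp_norm_powr p g"
proof -
  have "ennreal (\<bar>f x + g x\<bar> powr p) \<le> ennreal ((1 - l) powr (1 - p)) * ennreal (\<bar>f x\<bar> powr p)
      + ennreal (l powr (1 - p)) * ennreal (\<bar>g x\<bar> powr p)" for x
    using abs_powr_add_le[OF assms(3-5), of "f x" "g x"]
    by (simp add: ennreal_mult[symmetric] ennreal_plus[symmetric] del: ennreal_plus)
  then show ?thesis
    unfolding Lp_norm_powr_def
    by (subst (1 2) nn_integral_cmult[symmetric], simp, simp, subst nn_integral_add[symmetric], simp, simp)
      (intro nn_integral_mono)
qed

lemma Lp_norm_powr_minus_commute:
  "Lp_norm_powr p (\<lambda>x. f x - g x) = Lp_norm_powr p (\<lambda>x. g x - f x)"
  by (simp add: Lp_norm_powr_def abs_minus_commute)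

lemma Lp_tendsto_0_dominated:
  fixes D :: "nat \<Rightarrow> 'a::euclidean_space \<Rightarrow> real"
  assumes [measurable]: "\<And>n. D n \<in> borel_measurable borel" "w \<in> borel_measurable borel"
    and p: "0 < p"
    and bound: "\<And>n x. \<bar>D n x\<bar> \<le> \<bar>w x\<bar>" and w: "Lp_norm_powr p w < \<infinity>"
    and lim: "AE x in lborel. (\<lambda>n. D n x) \<longlonglongrightarrow> 0"
  shows "(\<lambda>n. Lp_norm_powr p (D n)) \<longlonglongrightarrow> 0"
proof -
  have "(\<lambda>n. Lp_norm_powr p (D n)) \<longlonglongrightarrow> (\<integral>\<^sup>+(x::'a). 0 \<partial>lborel)"
    unfolding Lp_norm_powr_def
  proof (rule nn_integral_dominated_convergence[where w = "\<lambda>x. ennreal (\<bar>w x\<bar> powr p)"])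
    show "AE x in lborel. ennreal (\<bar>D n x\<bar> powr p) \<le> ennreal (\<bar>w x\<bar> powr p)" for n
      using p bound by (auto intro!: ennreal_leI powr_mono2)
    show "(\<integral>\<^sup>+x. ennreal (\<bar>w x\<bar> powr p) \<partial>lborel) < \<infinity>"
      using w by (simp add: Lp_norm_powr_def)
    show "AE x in lborel. (\<lambda>n. ennreal (\<bar>D n x\<bar> powr p)) \<longlonglongrightarrow> 0"
      using lim
    proof eventually_elim
      case (elim x)
      then have "(\<lambda>n. \<bar>D n x\<bar> powr p) \<longlonglongrightarrow> \<bar>0\<bar> powr p"
        using p by (intro tendsto_powr2 tendsto_rabs tendsto_const) auto
      then show ?case by (metis abs_zero ennreal_0 powr_zero_eq_one tendsto_ennrealI powr_0)
    qed
  qed auto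
  then show ?thesis by simp
qed

text \<open>
  Truncating the values of \<open>f\<close> and multiplying by a continuous spatial cutoff gives a bounded function \<open>F n\<close>
  with bounded support that is close to \<open>f\<close>. A measurable function is an almost everywhere limit of
  continuous functions \<open>g k\<close>; these receive the same truncation and cutoff, so that the
  approximations of \<open>F n\<close> have a common majorant in \<open>L\<^sup>p\<close>.
\<close>
lemma Lp_dense_continuous:
  fixes f :: "'a::euclidean_space \<Rightarrow> real"
  assumes f[measurable]: "f \<in> borel_measurable borel" and fin: "Lp_norm_powr p f < \<infinity>"
    and p: "1 < p" and e: "0 < e"
  obtains h R where "continuous_on UNIV h" "\<And>x. R < norm x \<Longrightarrow> h x = 0" "Lp_norm_powr p (\<lambda>x. f x - h x) < ennreal e"
proof -
  define cl where "cl n u = max (- real n) (min (real n) u)" for n u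
  define ch :: "nat \<Rightarrow> 'a \<Rightarrow> real" where "ch n x = max 0 (min 1 (real n + 1 - norm x))" for n x
  define F where "F n x = cl n (f x) * ch n x" for n x
  have ch: "0 \<le> ch n x" "ch n x \<le> 1" for n x by (auto simp: ch_def)
  have cl: "\<bar>cl n u\<bar> \<le> \<bar>u\<bar>" "\<bar>cl n u\<bar> \<le> real n" for n u by (auto simp: cl_def)
  have [measurable]: "cl n \<in> borel_measurable borel" "ch n \<in> borel_measurable borel" for n
    unfolding cl_def[abs_def] ch_def[abs_def] by measurable
  have Fm[measurable]: "F n \<in> borel_measurable borel" for n unfolding F_def[abs_def] by measurable
  define d where "d = (1/2) powr (1 - p)"
  define e' where "e' = e / (4 * d)"
  have d: "0 < d" "0 < e'" using e by (simp_all add: d_def e'_def)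
  have "(\<lambda>n. Lp_norm_powr p (\<lambda>x. f x - F n x)) \<longlonglongrightarrow> 0"
  proof (rule Lp_tendsto_0_dominated[where w = f])
    show "\<bar>f x - F n x\<bar> \<le> \<bar>f x\<bar>" for n x
    proof -
      have "\<bar>F n x\<bar> \<le> \<bar>f x\<bar>"
        using mult_mono[OF cl(1)[of n "f x"] ch(2)[of n x]] ch(1)[of n x] by (simp add: F_def abs_mult)
      moreover have "0 \<le> f x * F n x"
      proof -
        have "0 \<le> f x * cl n (f x)"
          by (cases "0 \<le> f x") (auto simp: cl_def zero_le_mult_iff)
        from mult_nonneg_nonneg[OF this ch(1)] show ?thesis by (simp add: F_def mult.assoc)
      qed
      ultimately show ?thesis
        by (cases "0 \<le> f x"; cases "0 \<le> F n x") (auto simp: zero_le_mult_iff)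
    qed
    show "AE x in lborel. (\<lambda>n. f x - F n x) \<longlonglongrightarrow> 0"
    proof (rule AE_I2)
      fix x
      obtain N where N: "\<bar>f x\<bar> + norm x \<le> real N" using real_arch_simple by blast
      have "F n x = f x" if "N \<le> n" for n
      proof -
        have "\<bar>f x\<bar> \<le> real n" "norm x \<le> real n" using N that norm_ge_zero[of x] abs_ge_zero[of "f x"] by linarith+
        then show ?thesis by (simp add: F_def cl_def ch_def)
      qed
      then show "(\<lambda>n. f x - F n x) \<longlonglongrightarrow> 0"
        by (intro tendsto_eventually eventually_sequentiallyI[of N]) simp
    qed
  qed (use p fin in auto)
  then have "\<forall>\<^sub>F n in sequentially. Lp_norm_powr p (\<lambda>x. f x - F n x) < ennreal e'"
    by (rule order_tendstoD) (use d in simp)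
  then obtain n where n: "Lp_norm_powr p (\<lambda>x. f x - F n x) < ennreal e'"
    by (auto simp: eventually_sequentially)
  have "f \<in> borel_measurable lebesgue" using f by (simp add: measurable_completion)
  then have "f measurable_on UNIV" by (intro lebesgue_measurable_imp_measurable_on_real) auto
  then obtain N g where N: "negligible N" and g: "\<And>k. continuous_on UNIV (g k)"
    and lim: "\<And>x. x \<notin> N \<Longrightarrow> (\<lambda>k. g k x) \<longlonglongrightarrow> f x"
    unfolding measurable_on_def by auto
  define h where "h k x = cl n (g k x) * ch n x" for k :: nat and x
  have hc: "continuous_on UNIV (h k)" for k
    unfolding h_def[abs_def] cl_def ch_def by (intro continuous_intros g)
  have [measurable]: "h k \<in> borel_measurable borel" for k
    using hc by (rule borel_measurable_continuous_onI)
  have ae: "AE x in lborel. x \<notin> N"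
  proof -
    have "N \<in> null_sets lebesgue" using N by (simp add: negligible_iff_null_sets)
    then have "AE x in lebesgue. x \<notin> N" by (rule AE_not_in)
    then show ?thesis by (simp add: AE_completion_iff)
  qed
  have "(\<lambda>k. Lp_norm_powr p (\<lambda>x. F n x - h k x)) \<longlonglongrightarrow> 0"
  proof (rule Lp_tendsto_0_dominated[where w = "\<lambda>x. 2 * real n * indicator (cball 0 (real n + 1)) x"])
    show "\<bar>F n x - h k x\<bar> \<le> \<bar>2 * real n * indicator (cball 0 (real n + 1)) x\<bar>" for k x
    proof (cases "x \<in> cball 0 (real n + 1)")
      case False
      then have "ch n x = 0" by (simp add: ch_def)
      then show ?thesis by (simp add: F_def h_def)
    next
      case True
      have "\<bar>F n x - h k x\<bar> = \<bar>cl n (f x) - cl n (g k x)\<bar> * ch n x"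
        using ch(1)[of n x] by (simp add: F_def h_def abs_mult left_diff_distrib[symmetric])
      also have "\<dots> \<le> (2 * real n) * 1"
        using cl(2)[of n "f x"] cl(2)[of n "g k x"] ch[of n x] by (intro mult_mono) auto
      finally show ?thesis using True by simp
    qed
    have "Lp_norm_powr p (\<lambda>x::'a. 2 * real n * indicator (cball 0 (real n + 1)) x)
       = (\<integral>\<^sup>+(x::'a). ennreal ((2 * real n) powr p) * indicator (cball 0 (real n + 1)) x \<partial>lborel)"
      unfolding Lp_norm_powr_def by (intro nn_integral_cong) (auto simp: indicator_def)
    also have "\<dots> = ennreal ((2 * real n) powr p) * emeasure lborel (cball (0::'a) (real n + 1))"
      by (rule nn_integral_cmult_indicator) simp
    also have "\<dots> < \<infinity>"
      using emeasure_bounded_finite[OF bounded_cball, of "0::'a" "real n + 1"]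
      by (simp add: ennreal_mult_less_top)
    finally show "Lp_norm_powr p (\<lambda>x::'a. 2 * real n * indicator (cball 0 (real n + 1)) x) < \<infinity>" .
    show "AE x in lborel. (\<lambda>k. F n x - h k x) \<longlonglongrightarrow> 0"
      using ae
    proof eventually_elim
      case (elim x)
      have "(\<lambda>k. F n x - h k x) \<longlonglongrightarrow> F n x - max (- real n) (min (real n) (f x)) * ch n x"
        unfolding h_def cl_def by (intro tendsto_intros lim elim)
      then show ?case by (simp add: F_def cl_def)
    qed
    show "(\<lambda>x::'a. 2 * real n * indicator (cball 0 (real n + 1)) x) \<in> borel_measurable borel"
      by (intro borel_measurable_times borel_measurable_const borel_measurable_indicator) auto
  qed (use p in auto)
  then have "\<forall>\<^sub>F k in sequentially. Lp_norm_powr p (\<lambda>x. F n x - h k x) < ennreal e'"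
    by (rule order_tendstoD) (use d in simp)
  then obtain k where k: "Lp_norm_powr p (\<lambda>x. F n x - h k x) < ennreal e'"
    by (auto simp: eventually_sequentially)
  have "Lp_norm_powr p (\<lambda>x. f x - h k x) = Lp_norm_powr p (\<lambda>x. (f x - F n x) + (F n x - h k x))" by simp
  also have "\<dots> \<le> ennreal d * Lp_norm_powr p (\<lambda>x. f x - F n x) + ennreal d * Lp_norm_powr p (\<lambda>x. F n x - h k x)"
    using Lp_norm_powr_add_le[of "\<lambda>x. f x - F n x" "\<lambda>x. F n x - h k x" p "1/2"] p by (simp add: d_def)
  also have "\<dots> \<le> ennreal d * ennreal e' + ennreal d * ennreal e'"
    using n k by (intro add_mono mult_left_mono) auto
  also have "\<dots> = ennreal (e / 2)"
    using d e by (simp add: ennreal_mult[symmetric] ennreal_plus[symmetric] e'_def del: ennreal_plus)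
  also have "\<dots> < ennreal e" using e by (simp add: ennreal_less_iff)
  finally have "Lp_norm_powr p (\<lambda>x. f x - h k x) < ennreal e" .
  moreover have "h k x = 0" if "real n + 1 < norm x" for x
    using that by (simp add: h_def ch_def)
  ultimately show thesis using that hc by blast
qed

lemma Lp_continuous_bounded_support:
  fixes h :: "'a::euclidean_space \<Rightarrow> real"
  assumes "continuous_on UNIV h" "\<And>x. R < norm x \<Longrightarrow> h x = 0" "0 < p"
  shows "Lp_norm_powr p h < \<infinity>"
proof -
  have "continuous_on UNIV (\<lambda>x. \<bar>h x\<bar> powr p)"
    using assms by (intro continuous_on_powr' continuous_intros) auto
  then have "integrable lborel (\<lambda>x. \<bar>h x\<bar> powr p)"
    using assms by (intro integrable_continuous_bounded_support[where R = R]) auto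
  then show ?thesis
    unfolding Lp_norm_powr_def by (subst nn_integral_eq_integral) auto
qed

lemma heat_conv_add:
  fixes f g :: "'a::euclidean_space \<Rightarrow> real"
  assumes "gauss_integrable f" "gauss_integrable g" "0 < t"
  shows "heat_conv (\<lambda>x. f x + g x) heat_kernel t x = heat_conv f heat_kernel t x + heat_conv g heat_kernel t x"
  unfolding heat_conv_def using assms
  by (simp add: distrib_right integrable_times_heat_kernel)

section \<open>The \<open>L\<^sup>p\<close> norm of the semigroup for large and for small times\<close>

text \<open>
  The convolution is bounded by \<open>B t\<close>, a negative power of \<open>t\<close> times the integral of \<open>\<bar>h\<bar>\<close>. Because
  \<open>p > 1\<close> there is an exponent \<open>q\<close> strictly between \<open>1\<close> and \<open>p\<close>; then \<open>\<bar>u\<bar> powr p \<le> B t powr (p - q) * \<bar>u\<bar> powr q\<close>,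
  and the contraction property in \<open>L\<^sup>q\<close> bounds the integral of the last factor.
\<close>
lemma heat_conv_decay_continuous:
  fixes h :: "'a::euclidean_space \<Rightarrow> real"
  assumes h: "continuous_on UNIV h" "\<And>x. R < norm x \<Longrightarrow> h x = 0" and p: "1 < p"
  shows "((\<lambda>t. Lp_norm_powr p (heat_conv h heat_kernel t)) \<longlongrightarrow> 0) at_top"
proof -
  have [measurable]: "h \<in> borel_measurable borel" using h(1) by (rule borel_measurable_continuous_onI)
  define q where "q = (1 + p) / 2"
  have q: "1 < q" "q < p" using p by (auto simp: q_def)
  have fin: "Lp_norm_powr q h < \<infinity>" using Lp_continuous_bounded_support[OF h] q by simp
  have gi: "gauss_integrable h" using Lp_gauss_integrable[OF _ fin] q by simp
  have int: "integrable lborel (\<lambda>y. \<bar>h y\<bar>)"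
    using h by (intro integrable_abs integrable_continuous_bounded_support[where R = R]) auto
  define I where "I = (\<integral>y. \<bar>h y\<bar> \<partial>lborel)"
  have I: "0 \<le> I" by (simp add: I_def)
  define B where "B t = (4 * pi * t) powr (- real DIM('a) / 2) * I" for t
  have B: "\<bar>heat_conv h heat_kernel t x\<bar> \<le> B t" if t: "0 < t" for t x
  proof -
    have "\<bar>heat_conv h heat_kernel t x\<bar> \<le> (\<integral>y. \<bar>h y * heat_kernel t (x - y)\<bar> \<partial>lborel)"
      unfolding heat_conv_def by (rule integral_abs_bound)
    also have "\<dots> \<le> (\<integral>y. (4 * pi * t) powr (- real DIM('a) / 2) * \<bar>h y\<bar> \<partial>lborel)"
    proof (rule integral_mono)
      show "integrable lborel (\<lambda>y. \<bar>h y * heat_kernel t (x - y)\<bar>)"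
        by (intro integrable_abs integrable_times_heat_kernel gi t)
      show "integrable lborel (\<lambda>y. (4 * pi * t) powr (- real DIM('a) / 2) * \<bar>h y\<bar>)"
        by (intro integrable_mult_right int)
      fix y show "\<bar>h y * heat_kernel t (x - y)\<bar> \<le> (4 * pi * t) powr (- real DIM('a) / 2) * \<bar>h y\<bar>"
        using mult_right_mono[OF heat_kernel_le[OF t, of "x - y"] abs_ge_zero[of "h y"]]
        by (simp add: abs_mult heat_kernel_nonneg mult.commute)
    qed
    finally show ?thesis by (simp add: B_def I_def)
  qed
  have le: "Lp_norm_powr p (heat_conv h heat_kernel t) \<le> ennreal (B t powr (p - q)) * Lp_norm_powr q h" if t: "0 < t" for t
  proof -
    have "ennreal (\<bar>heat_conv h heat_kernel t x\<bar> powr p) \<le> ennreal (B t powr (p - q)) * ennreal (\<bar>heat_conv h heat_kernel t x\<bar> powr q)" for x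
    proof -
      have "\<bar>heat_conv h heat_kernel t x\<bar> powr p = \<bar>heat_conv h heat_kernel t x\<bar> powr (p - q) * \<bar>heat_conv h heat_kernel t x\<bar> powr q"
        by (simp add: powr_add[symmetric])
      also have "\<dots> \<le> B t powr (p - q) * \<bar>heat_conv h heat_kernel t x\<bar> powr q"
        using B[OF t, of x] q by (intro mult_right_mono powr_mono2) auto
      finally show ?thesis by (simp add: ennreal_mult[symmetric] ennreal_leI)
    qed
    then have "Lp_norm_powr p (heat_conv h heat_kernel t) \<le> ennreal (B t powr (p - q)) * Lp_norm_powr q (heat_conv h heat_kernel t)"
      unfolding Lp_norm_powr_def
      by (subst nn_integral_cmult[symmetric]) (auto intro!: nn_integral_mono)
    also have "\<dots> \<le> ennreal (B t powr (p - q)) * Lp_norm_powr q h"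
      using t q fin by (intro mult_left_mono heat_contraction) auto
    finally show ?thesis .
  qed
  have "real DIM('a) > 0" by simp
  then have "((\<lambda>t. (4 * pi * t) powr (- real DIM('a) / 2)) \<longlongrightarrow> 0) at_top"
    by real_asymp
  then have "(B \<longlongrightarrow> 0) at_top"
    unfolding B_def[abs_def] by (rule tendsto_mult_left_zero)
  then have "((\<lambda>t. B t powr (p - q)) \<longlongrightarrow> 0 powr (p - q)) at_top"
    by (rule tendsto_powr2[OF _ tendsto_const]) (use q I in \<open>auto simp: B_def\<close>)
  then have "((\<lambda>t. B t powr (p - q) * enn2real (Lp_norm_powr q h)) \<longlongrightarrow> 0) at_top"
    by (intro tendsto_mult_left_zero) simp
  then have "((\<lambda>t. ennreal (B t powr (p - q) * enn2real (Lp_norm_powr q h))) \<longlongrightarrow> 0) at_top"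
    using tendsto_ennrealI by fastforce
  moreover have "ennreal (B t powr (p - q) * enn2real (Lp_norm_powr q h)) = ennreal (B t powr (p - q)) * Lp_norm_powr q h" for t
    using fin by (simp add: ennreal_mult)
  ultimately have lim: "((\<lambda>t. ennreal (B t powr (p - q)) * Lp_norm_powr q h) \<longlongrightarrow> 0) at_top" by simp
  show ?thesis
    by (rule tendsto_sandwich[OF _ _ tendsto_const lim])
      (auto intro!: eventually_mono[OF eventually_gt_at_top[of 0]] le)
qed

lemma heat_conv_decay:
  fixes f :: "'a::euclidean_space \<Rightarrow> real"
  assumes [measurable]: "f \<in> borel_measurable borel" and fin: "Lp_norm_powr p f < \<infinity>"
    and p: "1 < p" and e: "0 < e"
  shows "\<forall>\<^sub>F t in at_top. Lp_norm_powr p (heat_conv f heat_kernel t) < ennreal e"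
proof -
  define d where "d = (1/2) powr (1 - p)"
  define e' where "e' = e / (4 * d)"
  have d: "0 < d" "0 < e'" using e by (simp_all add: d_def e'_def)
  obtain h R where h: "continuous_on UNIV h" "\<And>x. R < norm x \<Longrightarrow> h x = 0" "Lp_norm_powr p (\<lambda>x. f x - h x) < ennreal e'"
    using Lp_dense_continuous[OF assms(1) fin p d(2)] by blast
  have [measurable]: "h \<in> borel_measurable borel" using h(1) by (rule borel_measurable_continuous_onI)
  have gh: "gauss_integrable h"
    using Lp_gauss_integrable[OF _ Lp_continuous_bounded_support[OF h(1,2)], where p = p] p by simp
  have find: "Lp_norm_powr p (\<lambda>x. f x - h x) < \<infinity>" using h(3) by (rule less_trans) simp
  have gd: "gauss_integrable (\<lambda>x. f x - h x)"
    using Lp_gauss_integrable[OF _ find] p by simp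
  have "\<forall>\<^sub>F t in at_top. Lp_norm_powr p (heat_conv h heat_kernel t) < ennreal e'"
    using d by (intro order_tendstoD[OF heat_conv_decay_continuous[OF h(1,2) p]]) auto
  then show ?thesis
    using eventually_gt_at_top[of 0]
  proof eventually_elim
    case (elim t)
    have "heat_conv f heat_kernel t = (\<lambda>x. heat_conv h heat_kernel t x + heat_conv (\<lambda>x. f x - h x) heat_kernel t x)"
      using heat_conv_add[OF gh gd elim(2)] by (intro ext) simp
    then have "Lp_norm_powr p (heat_conv f heat_kernel t) \<le> ennreal d * Lp_norm_powr p (heat_conv h heat_kernel t)
        + ennreal d * Lp_norm_powr p (heat_conv (\<lambda>x. f x - h x) heat_kernel t)"
      using Lp_norm_powr_add_le[of "heat_conv h heat_kernel t" "heat_conv (\<lambda>x. f x - h x) heat_kernel t" p "1/2"] p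
      by (simp add: d_def)
    also have "\<dots> \<le> ennreal d * ennreal e' + ennreal d * ennreal e'"
      using elim heat_contraction[OF _ find p elim(2)] h(3)
      by (intro add_mono mult_left_mono) auto
    also have "\<dots> = ennreal (e / 2)"
      using d e by (simp add: ennreal_mult[symmetric] ennreal_plus[symmetric] e'_def del: ennreal_plus)
    also have "\<dots> < ennreal e" using e by (simp add: ennreal_less_iff)
    finally show ?case .
  qed
qed

lemma heat_kernel_scaling:
  fixes z :: "'a::euclidean_space"
  assumes "0 < t"
  shows "sqrt t ^ DIM('a) * heat_kernel t (sqrt t *\<^sub>R z) = heat_kernel 1 z"
proof -
  have "sqrt t ^ DIM('a) = t powr (real DIM('a) / 2)"
    using assms by (simp add: powr_half_sqrt[symmetric] powr_power)
  moreover have "(4 * pi * t) powr (- real DIM('a) / 2) = (4 * pi) powr (- real DIM('a) / 2) * t powr (- real DIM('a) / 2)"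
    by (rule powr_mult)
  moreover have "t powr (real DIM('a) / 2) * t powr (- real DIM('a) / 2) = 1"
    using assms by (simp add: powr_add[symmetric])
  ultimately show ?thesis
    using assms by (simp add: heat_kernel_def power_mult_distrib)
qed

text \<open>
  The substitution \<open>y = x - sqrt t *\<^sub>R z\<close> turns the kernel into the fixed density \<open>heat_kernel 1 z\<close> and moves
  the time dependence into the argument of the continuous function \<open>h\<close>.
\<close>
lemma heat_conv_tendsto_initial:
  fixes h :: "'a::euclidean_space \<Rightarrow> real"
  assumes h: "continuous_on UNIV h" "\<And>x. R < norm x \<Longrightarrow> h x = 0"
    and s: "\<And>n. 0 < s n" "s \<longlonglongrightarrow> (0::real)"
  shows "(\<lambda>n. heat_conv h heat_kernel (s n) x) \<longlonglongrightarrow> h x"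
proof -
  have [measurable]: "h \<in> borel_measurable borel" using h(1) by (rule borel_measurable_continuous_onI)
  obtain C where C: "0 \<le> C" "\<And>x. \<bar>h x\<bar> \<le> C" using continuous_bounded_support_bound[OF h] by blast
  have int1: "integrable lborel (heat_kernel 1 :: 'a \<Rightarrow> real)"
    using nn_integral_heat_kernel[of 1, where 'a = 'a] by (intro integrableI_nonneg) (auto simp: heat_kernel_nonneg)
  have eq: "heat_conv h heat_kernel t x = (\<integral>z. h (x - sqrt t *\<^sub>R z) * heat_kernel 1 z \<partial>lborel)" if t: "0 < t" for t
  proof -
    have "heat_conv h heat_kernel t x =
        sqrt t ^ DIM('a) * (\<integral>z. h (x - sqrt t *\<^sub>R z) * heat_kernel t (sqrt t *\<^sub>R z) \<partial>lborel)"
      unfolding heat_conv_def using t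
      by (subst integral_lborel_affine[where c = "- sqrt t" and x = x]) auto
    also have "\<dots> = (\<integral>z. h (x - sqrt t *\<^sub>R z) * (sqrt t ^ DIM('a) * heat_kernel t (sqrt t *\<^sub>R z)) \<partial>lborel)"
      by (simp add: mult.left_commute)
    finally show ?thesis by (simp add: heat_kernel_scaling[OF t])
  qed
  have "(\<lambda>n. \<integral>z. h (x - sqrt (s n) *\<^sub>R z) * heat_kernel 1 z \<partial>lborel) \<longlonglongrightarrow> (\<integral>(z::'a). h x * heat_kernel 1 z \<partial>lborel)"
  proof (rule integral_dominated_convergence[where w = "\<lambda>z::'a. C * heat_kernel 1 z"])
    show "AE z in lborel. (\<lambda>n. h (x - sqrt (s n) *\<^sub>R z) * heat_kernel 1 z) \<longlonglongrightarrow> h x * heat_kernel 1 z"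
    proof (rule AE_I2)
      fix z
      have "(\<lambda>n. x - sqrt (s n) *\<^sub>R z) \<longlonglongrightarrow> x - sqrt 0 *\<^sub>R z" by (intro tendsto_intros s)
      then have "(\<lambda>n. h (x - sqrt (s n) *\<^sub>R z)) \<longlonglongrightarrow> h x"
        using continuous_on_tendsto_compose[OF h(1)] by fastforce
      then show "(\<lambda>n. h (x - sqrt (s n) *\<^sub>R z) * heat_kernel 1 z) \<longlonglongrightarrow> h x * heat_kernel 1 z"
        by (intro tendsto_intros)
    qed
    show "AE z in lborel. norm (h (x - sqrt (s n) *\<^sub>R z) * heat_kernel 1 z) \<le> C * heat_kernel 1 z" for n
      using C by (intro AE_I2) (simp add: abs_mult heat_kernel_nonneg mult_right_mono)
  qed (use int1 in auto)
  moreover have "(\<integral>(z::'a). heat_kernel 1 z \<partial>lborel) = 1"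
    using nn_integral_heat_kernel[of 1, where 'a = 'a]
    by (subst integral_eq_nn_integral) (auto simp: heat_kernel_nonneg)
  ultimately show ?thesis using s(1) by (simp add: eq)
qed

text \<open>
  Lower semicontinuity of the \<open>L\<^sup>p\<close> norm as time tends to \<open>0\<close>. For continuous \<open>h\<close> with bounded support it is
  Fatou's lemma. For general \<open>f\<close> take such an \<open>h\<close> close to \<open>f\<close>: by contraction the semigroups of \<open>f\<close> and \<open>h\<close>
  stay close at all times. The two uses of \<open>Lp_norm_powr_add_le\<close> cost a factor \<open>a\<^sup>2\<close> and an
  error proportional to \<open>e\<close>; letting first \<open>e\<close> and then \<open>l\<close> tend to \<open>0\<close> removes both.
\<close>
lemma heat_conv_initial_lower:
  fixes f :: "'a::euclidean_space \<Rightarrow> real"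
  assumes [measurable]: "f \<in> borel_measurable borel" and fin: "Lp_norm_powr p f < \<infinity>"
    and p: "1 < p" and S: "\<And>t. 0 < t \<Longrightarrow> Lp_norm_powr p (heat_conv f heat_kernel t) \<le> ennreal S" and S0: "0 \<le> S"
  shows "Lp_norm_powr p f \<le> ennreal S"
proof -
  define A where "A = enn2real (Lp_norm_powr p f)"
  have A: "Lp_norm_powr p f = ennreal A" "0 \<le> A" using fin by (simp_all add: A_def)
  have main: "A \<le> a * (a * S + b * e) + b * e"
    if l: "0 < l" "l < 1" and e: "0 < e" and a: "a = (1 - l) powr (1 - p)" and b: "b = l powr (1 - p)" for l e a b
  proof -
    have ab: "0 \<le> a" "0 \<le> b" by (auto simp: a b)
    obtain h R where h: "continuous_on UNIV h" "\<And>x. R < norm x \<Longrightarrow> h x = 0" "Lp_norm_powr p (\<lambda>x. f x - h x) < ennreal e"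
      using Lp_dense_continuous[OF assms(1) fin p e] by blast
    have [measurable]: "h \<in> borel_measurable borel" using h(1) by (rule borel_measurable_continuous_onI)
    have hf: "Lp_norm_powr p (\<lambda>x. h x - f x) \<le> ennreal e" using h(3) by (subst Lp_norm_powr_minus_commute) simp
    then have find: "Lp_norm_powr p (\<lambda>x. h x - f x) < \<infinity>" by (rule le_less_trans) simp
    have gf: "gauss_integrable f" and gd: "gauss_integrable (\<lambda>x. h x - f x)"
      using Lp_gauss_integrable[OF _ fin] Lp_gauss_integrable[OF _ find] p by auto
    have uh: "Lp_norm_powr p (heat_conv h heat_kernel t) \<le> ennreal (a * S + b * e)" if t: "0 < t" for t
    proof -
      have "heat_conv h heat_kernel t = (\<lambda>x. heat_conv f heat_kernel t x + heat_conv (\<lambda>x. h x - f x) heat_kernel t x)"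
        using heat_conv_add[OF gf gd t] by (intro ext) simp
      then have "Lp_norm_powr p (heat_conv h heat_kernel t) \<le> ennreal a * Lp_norm_powr p (heat_conv f heat_kernel t)
        + ennreal b * Lp_norm_powr p (heat_conv (\<lambda>x. h x - f x) heat_kernel t)"
        using Lp_norm_powr_add_le[of "heat_conv f heat_kernel t" "heat_conv (\<lambda>x. h x - f x) heat_kernel t" p l] p l
        by (simp add: a b)
      also have "\<dots> \<le> ennreal a * ennreal S + ennreal b * ennreal e"
        using S[OF t] heat_contraction[OF _ find p t] hf
        by (intro add_mono mult_left_mono) (auto intro: order_trans)
      finally show ?thesis using ab S0 e by (simp add: ennreal_mult ennreal_plus)
    qed
    define s where "s n = inverse (real (Suc n))" for n
    have s: "\<And>n. 0 < s n" "s \<longlonglongrightarrow> 0" using LIMSEQ_inverse_real_of_nat by (auto simp: s_def[abs_def])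
    have "Lp_norm_powr p h = (\<integral>\<^sup>+x. liminf (\<lambda>n. ennreal (\<bar>heat_conv h heat_kernel (s n) x\<bar> powr p)) \<partial>lborel)"
      unfolding Lp_norm_powr_def
    proof (rule nn_integral_cong)
      fix x
      have "(\<lambda>n. \<bar>heat_conv h heat_kernel (s n) x\<bar> powr p) \<longlonglongrightarrow> \<bar>h x\<bar> powr p"
        using p by (intro tendsto_powr2 tendsto_rabs heat_conv_tendsto_initial[OF h(1,2) s] tendsto_const) auto
      then have "(\<lambda>n. ennreal (\<bar>heat_conv h heat_kernel (s n) x\<bar> powr p)) \<longlonglongrightarrow> ennreal (\<bar>h x\<bar> powr p)"
        by (rule tendsto_ennrealI)
      then show "ennreal (\<bar>h x\<bar> powr p) = liminf (\<lambda>n. ennreal (\<bar>heat_conv h heat_kernel (s n) x\<bar> powr p))"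
        using lim_imp_Liminf[OF sequentially_bot] by metis
    qed
    also have "\<dots> \<le> liminf (\<lambda>n. Lp_norm_powr p (heat_conv h heat_kernel (s n)))"
      unfolding Lp_norm_powr_def by (rule nn_integral_liminf) simp
    also have "\<dots> \<le> liminf (\<lambda>n::nat. ennreal (a * S + b * e))"
      by (intro Liminf_mono always_eventually allI uh s)
    also have "\<dots> = ennreal (a * S + b * e)" by (simp add: Liminf_const)
    finally have Nh: "Lp_norm_powr p h \<le> ennreal (a * S + b * e)" .
    have "Lp_norm_powr p f = Lp_norm_powr p (\<lambda>x. h x + (f x - h x))" by simp
    also have "\<dots> \<le> ennreal a * Lp_norm_powr p h + ennreal b * Lp_norm_powr p (\<lambda>x. f x - h x)"
      unfolding a b using p l by (intro Lp_norm_powr_add_le) auto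
    also have "\<dots> \<le> ennreal a * ennreal (a * S + b * e) + ennreal b * ennreal e"
      using Nh h(3) by (intro add_mono mult_left_mono) auto
    also have "\<dots> = ennreal (a * (a * S + b * e) + b * e)"
      using ab S0 e by (simp add: ennreal_mult ennreal_plus)
    finally have "ennreal A \<le> ennreal (a * (a * S + b * e) + b * e)" unfolding A(1) .
    then show ?thesis using ab S0 e by (subst (asm) ennreal_le_iff) auto
  qed
  have l: "A \<le> ((1 - l) powr (1 - p))\<^sup>2 * S" if l: "0 < l" "l < 1" for l
  proof (rule tendsto_lowerbound[where F = "at_right 0"])
    show "((\<lambda>e. (1 - l) powr (1 - p) * ((1 - l) powr (1 - p) * S + l powr (1 - p) * e) + l powr (1 - p) * e)
        \<longlongrightarrow> ((1 - l) powr (1 - p))\<^sup>2 * S) (at_right 0)"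
      by (auto intro!: tendsto_eq_intros simp: power2_eq_square)
    show "\<forall>\<^sub>F e in at_right 0. A \<le> (1 - l) powr (1 - p) * ((1 - l) powr (1 - p) * S + l powr (1 - p) * e) + l powr (1 - p) * e"
      using main[OF l _ refl refl] by (auto simp: eventually_at_filter)
  qed simp
  have "A \<le> S"
  proof (rule tendsto_lowerbound[where F = "at_right 0"])
    show "((\<lambda>l. ((1 - l) powr (1 - p))\<^sup>2 * S) \<longlongrightarrow> S) (at_right 0)"
      by (auto intro!: tendsto_eq_intros)
    show "\<forall>\<^sub>F x in at_right 0. A \<le> ((1 - x) powr (1 - p))\<^sup>2 * S"
      using l by (auto simp: eventually_at_right_field intro!: exI[of _ 1])
  qed simp
  then show ?thesis using A by (simp add: ennreal_leI)
qed

section \<open>Cutoff functions\<close>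

lemma max_0_power_deriv:
  fixes s :: real
  assumes k: "2 \<le> k"
  shows "((\<lambda>s. (max 0 s) ^ k) has_real_derivative real k * (max 0 s) ^ (k - 1)) (at s)"
proof -
  consider "0 < s" | "s < 0" | "s = 0" by linarith
  then show ?thesis
  proof cases
    case 1
    have "((\<lambda>s. s ^ k) has_real_derivative real k * s ^ (k - 1)) (at s)"
      using DERIV_pow[of k s] by simp
    then show ?thesis
      by (rule has_field_derivative_transform_within_open[where S = "{0<..}" and f = "\<lambda>s. s ^ k", THEN DERIV_cong])
        (use 1 in auto)
  next
    case 2
    have "((\<lambda>s::real. 0) has_real_derivative 0) (at s)" by (rule DERIV_const)
    then show ?thesis
      by (rule has_field_derivative_transform_within_open[where S = "{..<0}" and f = "\<lambda>s. 0", THEN DERIV_cong])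
        (use 2 k in auto)
  next
    case 3
    have "((\<lambda>y::real. (max 0 y) ^ (k - 1)) \<longlongrightarrow> (max 0 0) ^ (k - 1)) (at 0)" by (intro tendsto_intros)
    moreover have "\<forall>\<^sub>F y in at 0. (max 0 y) ^ (k - 1) = ((max 0 y) ^ k - (max 0 0) ^ k) / (y - 0 :: real)"
      using k by (auto simp: eventually_at_filter max_def power_diff power_0_left intro!: always_eventually)
    ultimately have "((\<lambda>y. ((max 0 y) ^ k - (max 0 0) ^ k) / (y - 0 :: real)) \<longlongrightarrow> (max 0 0) ^ (k - 1)) (at 0)"
      by (rule Lim_transform_eventually)
    then show ?thesis
      using k by (simp add: 3 has_field_derivative_iff power_0_left)
  qed
qed

text \<open>
  The third power makes the positive part twice continuously differentiable.
\<close>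
definition cutoff :: "real \<Rightarrow> 'a::euclidean_space \<Rightarrow> real" where
  "cutoff R x = (max 0 (1 - (norm x)\<^sup>2 / R)) ^ 3"

definition cutoff_dx :: "'a \<Rightarrow> real \<Rightarrow> 'a::euclidean_space \<Rightarrow> real" where
  "cutoff_dx e R x = 3 * (max 0 (1 - (norm x)\<^sup>2 / R))\<^sup>2 * (- 2 * (x \<bullet> e) / R)"

definition cutoff_dxx :: "'a \<Rightarrow> real \<Rightarrow> 'a::euclidean_space \<Rightarrow> real" where
  "cutoff_dxx e R x = 6 * max 0 (1 - (norm x)\<^sup>2 / R) * (2 * (x \<bullet> e) / R)\<^sup>2
     - 3 * (max 0 (1 - (norm x)\<^sup>2 / R))\<^sup>2 * (2 * (e \<bullet> e) / R)"

lemma line_norm_deriv: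
  fixes x e :: "'a::euclidean_space"
  shows "((\<lambda>s. 1 - (norm (x + s *\<^sub>R e))\<^sup>2 / R) has_real_derivative - 2 * (x \<bullet> e) / R) (at 0)"
proof -
  have "(norm (x + s *\<^sub>R e))\<^sup>2 = x \<bullet> x + 2 * s * (x \<bullet> e) + s\<^sup>2 * (e \<bullet> e)" for s
    unfolding power2_norm_eq_inner
    by (simp add: inner_add_left inner_add_right inner_commute power2_eq_square)
  moreover have "((\<lambda>s. 1 - (x \<bullet> x + 2 * s * (x \<bullet> e) + s\<^sup>2 * (e \<bullet> e)) / R) has_real_derivative - 2 * (x \<bullet> e) / R) (at 0)"
    by (cases "R = 0") (auto intro!: derivative_eq_intros simp: divide_simps)
  ultimately show ?thesis by simp
qed

lemma cutoff_line_deriv: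
  "((\<lambda>s. cutoff R (x + s *\<^sub>R e)) has_real_derivative cutoff_dx e R x) (at 0)"
proof -
  have "((\<lambda>s. (max 0 (1 - (norm (x + s *\<^sub>R e))\<^sup>2 / R)) ^ 3) has_real_derivative
      real 3 * (max 0 (1 - (norm (x + 0 *\<^sub>R e))\<^sup>2 / R)) ^ (3 - 1) * (- 2 * (x \<bullet> e) / R)) (at 0)"
    by (rule DERIV_chain2[where f = "\<lambda>s. (max 0 s) ^ 3", OF max_0_power_deriv line_norm_deriv]) simp
  then show ?thesis by (simp add: cutoff_def cutoff_dx_def)
qed

lemma cutoff_dx_line_deriv:
  "((\<lambda>s. cutoff_dx e R (x + s *\<^sub>R e)) has_real_derivative cutoff_dxx e R x) (at 0)"
proof -
  have "((\<lambda>s. (max 0 (1 - (norm (x + s *\<^sub>R e))\<^sup>2 / R)) ^ 2) has_real_derivative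
      real 2 * (max 0 (1 - (norm (x + 0 *\<^sub>R e))\<^sup>2 / R)) ^ (2 - 1) * (- 2 * (x \<bullet> e) / R)) (at 0)"
    by (rule DERIV_chain2[where f = "\<lambda>s. (max 0 s) ^ 2", OF max_0_power_deriv line_norm_deriv]) simp
  then have 1: "((\<lambda>s. 3 * (max 0 (1 - (norm (x + s *\<^sub>R e))\<^sup>2 / R))\<^sup>2) has_real_derivative
      3 * (2 * max 0 (1 - (norm x)\<^sup>2 / R) * (- 2 * (x \<bullet> e) / R))) (at 0)"
    by (intro DERIV_cmult) simp
  have 2: "((\<lambda>s. - 2 * ((x + s *\<^sub>R e) \<bullet> e) / R) has_real_derivative - 2 * (e \<bullet> e) / R) (at 0)"
    by (cases "R = 0") (auto intro!: derivative_eq_intros simp: inner_add_left)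
  from DERIV_mult[OF 1 2] show ?thesis
    unfolding cutoff_dx_def[abs_def]
    by (rule DERIV_cong) (simp add: cutoff_dxx_def power2_eq_square)
qed

lemma cutoff_continuous:
  "continuous_on UNIV (cutoff R)" "continuous_on UNIV (cutoff_dx e R)" "continuous_on UNIV (cutoff_dxx e R)"
  unfolding cutoff_def[abs_def] cutoff_dx_def[abs_def] cutoff_dxx_def[abs_def]
  by (cases "R = 0"; auto intro!: continuous_intros)+

lemma cutoff_support:
  assumes "1 \<le> R" "R < norm x"
  shows "cutoff R x = 0" "cutoff_dx e R x = 0" "cutoff_dxx e R x = 0"
proof -
  have "R * 1 \<le> norm x * norm x" using assms by (intro mult_mono) auto
  then have "max 0 (1 - (norm x)\<^sup>2 / R) = 0"
    using assms by (simp add: power2_eq_square field_simps)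
  then show "cutoff R x = 0" "cutoff_dx e R x = 0" "cutoff_dxx e R x = 0"
    by (simp_all add: cutoff_def cutoff_dx_def cutoff_dxx_def)
qed

lemma cutoff_bounds:
  assumes "0 < R"
  shows "0 \<le> cutoff R x" "cutoff R x \<le> 1"
  using assms by (auto simp: cutoff_def intro!: power_le_one)

lemma cutoff_mono:
  assumes "0 < R" "R \<le> R'"
  shows "cutoff R x \<le> cutoff R' x"
proof -
  have "(norm x)\<^sup>2 / R' \<le> (norm x)\<^sup>2 / R" using assms by (intro divide_left_mono) auto
  then show ?thesis unfolding cutoff_def by (intro power_mono) auto
qed

lemma cutoff_tendsto: "(\<lambda>n. cutoff (real (Suc n)) x) \<longlonglongrightarrow> 1"
proof -
  have "(\<lambda>n. (norm x)\<^sup>2 * inverse (real (Suc n))) \<longlonglongrightarrow> (norm x)\<^sup>2 * 0"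
    by (intro tendsto_intros LIMSEQ_inverse_real_of_nat)
  then have "(\<lambda>n. (norm x)\<^sup>2 / real (Suc n)) \<longlonglongrightarrow> 0" by (simp add: divide_inverse del: of_nat_Suc)
  then have "(\<lambda>n. cutoff (real (Suc n)) x) \<longlonglongrightarrow> (max 0 (1 - 0)) ^ 3"
    unfolding cutoff_def by (intro tendsto_intros)
  then show ?thesis by simp
qed

text \<open>
  With \<open>m\<close> the positive part of \<open>1 - (norm x)\<^sup>2 / R\<close>, the quantity \<open>m * (norm x)\<^sup>2 / R\<close> is at most \<open>1\<close> because
  \<open>m\<close> vanishes outside the ball \<open>(norm x)\<^sup>2 \<le> R\<close>. The decay in \<open>R\<close> makes the cutoff error disappear.
\<close>
lemma cutoff_laplacian_bound:
  fixes x :: "'a::euclidean_space"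
  assumes R: "0 < R"
  shows "\<bar>\<Sum>e\<in>Basis. cutoff_dxx e R x\<bar> \<le> (24 + 6 * DIM('a)) / R"
proof -
  define m where "m = max 0 (1 - (norm x)\<^sup>2 / R)"
  have m: "0 \<le> m" "m \<le> 1" using R by (auto simp: m_def)
  have nn: "m * ((norm x)\<^sup>2 / R) \<le> 1"
  proof (cases "(norm x)\<^sup>2 / R \<le> 1")
    case True
    then show ?thesis using m R mult_mono[of m 1 "(norm x)\<^sup>2 / R" 1] by simp
  qed (simp add: m_def)
  have sq: "(norm x)\<^sup>2 = (\<Sum>b\<in>Basis. (x \<bullet> b)\<^sup>2)"
    unfolding power2_norm_eq_inner by (subst euclidean_inner) (simp add: power2_eq_square)
  have "(\<Sum>e\<in>Basis. cutoff_dxx e R x) = (\<Sum>e\<in>Basis. 24 * m / R\<^sup>2 * (x \<bullet> e)\<^sup>2 - 6 * m\<^sup>2 / R)"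
    unfolding cutoff_dxx_def m_def[symmetric]
    by (intro sum.cong refl) (simp add: power2_eq_square)
  also have "\<dots> = 24 * m / R\<^sup>2 * (norm x)\<^sup>2 - DIM('a) * (6 * m\<^sup>2 / R)"
    by (simp add: sum_subtractf sq sum_distrib_left)
  also have "\<dots> = (24 * (m * ((norm x)\<^sup>2 / R)) - 6 * DIM('a) * m\<^sup>2) / R"
    using R by (simp add: power2_eq_square field_simps)
  finally have eq: "(\<Sum>e\<in>Basis. cutoff_dxx e R x) = (24 * (m * ((norm x)\<^sup>2 / R)) - 6 * DIM('a) * m\<^sup>2) / R" .
  have "0 \<le> m * ((norm x)\<^sup>2 / R)" using m R by simp
  moreover have "m\<^sup>2 \<le> 1" using m by (simp add: power_le_one)
  then have "6 * real DIM('a) * m\<^sup>2 \<le> 6 * real DIM('a) * 1" by (intro mult_left_mono) auto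
  moreover have "0 \<le> 6 * DIM('a) * m\<^sup>2" by simp
  ultimately have "\<bar>24 * (m * ((norm x)\<^sup>2 / R)) - 6 * DIM('a) * m\<^sup>2\<bar> \<le> 24 + 6 * DIM('a)"
    using nn by linarith
  then show ?thesis
    unfolding eq using R by (simp add: abs_divide divide_right_mono)
qed

section \<open>The localized energy identity\<close>

lemma has_derivative_line:
  fixes g :: "'a::real_normed_vector \<Rightarrow> real"
  assumes "(g has_derivative L) (at x)"
  shows "((\<lambda>s. g (x + s *\<^sub>R e)) has_real_derivative L e) (at 0)"
proof -
  have "((\<lambda>s. x + s *\<^sub>R e) has_derivative (\<lambda>s. s *\<^sub>R e)) (at 0)"
    by (auto intro!: derivative_eq_intros)
  moreover have "(g has_derivative L) (at (x + 0 *\<^sub>R e))" using assms by simp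
  ultimately have "((\<lambda>s. g (x + s *\<^sub>R e)) has_derivative (\<lambda>s. L (s *\<^sub>R e))) (at 0)"
    by (rule has_derivative_compose)
  moreover have "L (s *\<^sub>R e) = L e * s" for s
    using linear_scale[OF has_derivative_linear[OF assms], of s e] by simp
  ultimately show ?thesis by (simp add: has_field_derivative_def)
qed

lemma continuous_on_slice:
  assumes "continuous_on ({0<..} \<times> UNIV) (\<lambda>(t::real, x). g t x)" and "0 < t"
  shows "continuous_on UNIV (g t)"
proof -
  have "continuous_on UNIV (\<lambda>x. (\<lambda>(t, x). g t x) (t, x))"
    by (rule continuous_on_compose2[OF assms(1)]) (use assms(2) in \<open>auto intro!: continuous_intros\<close>)
  then show ?thesis by simp
qed

lemma local_bound_compact_support:
  fixes g :: "real \<Rightarrow> 'a::euclidean_space \<Rightarrow> real"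
  assumes cont: "continuous_on ({0<..} \<times> UNIV) (\<lambda>(t, x). g t x)"
    and supp: "\<And>t x. R < norm x \<Longrightarrow> g t x = 0" and a: "0 < a"
  obtains C where "\<And>t x. t \<in> {a..b} \<Longrightarrow> \<bar>g t x\<bar> \<le> C * indicator (cball 0 R) x"
proof -
  have "compact ((\<lambda>(t, x). g t x) ` ({a..b} \<times> cball 0 R))"
    using cont a by (intro compact_continuous_image compact_Times) (auto intro: continuous_on_subset)
  then obtain C where C: "0 < C" "\<And>t x. t \<in> {a..b} \<Longrightarrow> norm x \<le> R \<Longrightarrow> \<bar>g t x\<bar> \<le> C"
    by (fastforce simp: bounded_pos dest!: compact_imp_bounded)
  have "\<bar>g t x\<bar> \<le> C * indicator (cball 0 R) x" if "t \<in> {a..b}" for t x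
    using C(2)[OF that, of x] supp[of x t] by (cases "norm x \<le> R") auto
  then show thesis by (rule that)
qed

lemma integrable_const_indicator_cball:
  "integrable lborel (\<lambda>x::'a::euclidean_space. C * indicator (cball 0 R) x :: real)"
  using emeasure_bounded_finite[OF bounded_cball, of "0::'a" R]
  by (intro integrable_mult_right integrable_real_indicator) auto

lemma continuous_compact_support_integral:
  fixes g :: "real \<Rightarrow> 'a::euclidean_space \<Rightarrow> real"
  assumes cont: "continuous_on ({0<..} \<times> UNIV) (\<lambda>(t, x). g t x)"
    and meas: "\<And>t. g t \<in> borel_measurable borel"
    and supp: "\<And>t x. R < norm x \<Longrightarrow> g t x = 0" and t: "0 < t"
  shows "isCont (\<lambda>t. \<integral>x. g t x \<partial>lborel) t"
proof -
  obtain C where C: "\<And>s x. s \<in> {t/2..2*t} \<Longrightarrow> \<bar>g s x\<bar> \<le> C * indicator (cball 0 R) x"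
    using local_bound_compact_support[where R = R, OF cont supp, of "t/2" "2*t"] t by auto
  show ?thesis
  proof (rule isCont_integral_dominated[OF _ integrable_const_indicator_cball[of C R]])
    fix x
    have "continuous_on {0<..} (\<lambda>s. (\<lambda>(t, x). g t x) (s, x))"
      by (rule continuous_on_compose2[OF cont]) (auto intro!: continuous_intros)
    then show "isCont (\<lambda>s. g s x) t"
      using t by (subst (asm) continuous_on_eq_continuous_at) auto
  next
    show "\<forall>\<^sub>F z in nhds t. \<forall>y\<in>space lborel. \<bar>g z y\<bar> \<le> C * indicator (cball 0 R) y"
      using eventually_nhds_in_open[of "{t/2<..<2*t}" t] t by (auto intro!: C elim!: eventually_mono)
  qed (use meas in simp)
qed

text \<open>
  An energy density \<open>\<phi>\<close> with two continuous derivatives, evaluated along the heat flow \<open>u\<close> started at \<open>f\<close>.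
\<close>
locale heat_energy =
  fixes f :: "'a::euclidean_space \<Rightarrow> real" and \<phi> \<phi>' \<phi>'' :: "real \<Rightarrow> real"
  assumes f: "gauss_integrable f"
    and phi_deriv: "\<And>u. (\<phi> has_real_derivative \<phi>' u) (at u)"
    and phi'_deriv: "\<And>u. (\<phi>' has_real_derivative \<phi>'' u) (at u)"
    and phi''_continuous: "continuous_on UNIV \<phi>''"
begin

abbreviation "u \<equiv> heat_conv f heat_kernel"
abbreviation "ut \<equiv> heat_conv f heat_kernel_dt"
abbreviation "ux e \<equiv> heat_conv f (heat_kernel_dx e)"
abbreviation "uxx e \<equiv> heat_conv f (heat_kernel_dxx e e)"
abbreviation "grad2 t x \<equiv> \<Sum>e\<in>Basis. (ux e t x)\<^sup>2"

lemma f_measurable [measurable]: "f \<in> borel_measurable borel"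
  using gauss_integrableD(1)[OF f] .

lemma phi_continuous: "continuous_on UNIV \<phi>" "continuous_on UNIV \<phi>'"
  using DERIV_isCont[OF phi_deriv] DERIV_isCont[OF phi'_deriv] by (simp_all add: continuous_at_imp_continuous_on)

lemma energy_measurable [measurable]:
  "\<phi> \<in> borel_measurable borel" "\<phi>' \<in> borel_measurable borel" "\<phi>'' \<in> borel_measurable borel"
  "cutoff R \<in> borel_measurable (borel :: 'a measure)" "cutoff_dxx e R \<in> borel_measurable borel"
  by (intro borel_measurable_continuous_onI phi_continuous phi''_continuous cutoff_continuous)+

lemma u_continuous:
  "continuous_on ({0<..} \<times> UNIV) (\<lambda>(t, x). u t x)"
  "continuous_on ({0<..} \<times> UNIV) (\<lambda>(t, x). ut t x)"
  "continuous_on ({0<..} \<times> UNIV) (\<lambda>(t, x). ux e t x)"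
  "continuous_on ({0<..} \<times> UNIV) (\<lambda>(t, x). uxx e t x)"
  by (rule heat_conv_continuous_kernels[OF f])+

lemma weighted_continuous:
  assumes \<psi>: "continuous_on UNIV \<psi>" and g: "continuous_on UNIV g"
  shows "continuous_on ({0<..} \<times> UNIV) (\<lambda>(t, x). g (u t x) * \<psi> x)"
    and "continuous_on ({0<..} \<times> UNIV) (\<lambda>(t, x). g (u t x) * ut t x * \<psi> x)"
    and "continuous_on ({0<..} \<times> UNIV) (\<lambda>(t, x). g (u t x) * grad2 t x * \<psi> x)"
    and "continuous_on ({0<..} \<times> UNIV) (\<lambda>(t, x). g (u t x) * ux e t x * \<psi> x)"
    and "continuous_on ({0<..} \<times> UNIV) (\<lambda>(t, x). g (u t x) * uxx e t x * \<psi> x)"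
    and "continuous_on ({0<..} \<times> UNIV) (\<lambda>(t, x). g (u t x) * (ux e t x)\<^sup>2 * \<psi> x)"
proof -
  note c = u_continuous[unfolded split_def]
  have g': "continuous_on ({0<..} \<times> UNIV) (\<lambda>z. g (u (fst z) (snd z)))"
    by (rule continuous_on_compose2[OF g c(1)]) simp
  have \<psi>': "continuous_on ({0<..} \<times> UNIV) (\<lambda>z::real \<times> 'a. \<psi> (snd z))"
    by (rule continuous_on_compose2[OF \<psi> continuous_on_snd[OF continuous_on_id]]) simp
  show "continuous_on ({0<..} \<times> UNIV) (\<lambda>(t, x). g (u t x) * \<psi> x)"
    "continuous_on ({0<..} \<times> UNIV) (\<lambda>(t, x). g (u t x) * ut t x * \<psi> x)"
    "continuous_on ({0<..} \<times> UNIV) (\<lambda>(t, x). g (u t x) * grad2 t x * \<psi> x)"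
    "continuous_on ({0<..} \<times> UNIV) (\<lambda>(t, x). g (u t x) * ux e t x * \<psi> x)"
    "continuous_on ({0<..} \<times> UNIV) (\<lambda>(t, x). g (u t x) * uxx e t x * \<psi> x)"
    "continuous_on ({0<..} \<times> UNIV) (\<lambda>(t, x). g (u t x) * (ux e t x)\<^sup>2 * \<psi> x)"
    unfolding split_def
    by (intro continuous_on_mult continuous_on_sum continuous_on_power g' \<psi>' c)+
qed

text \<open>
  Write \<open>\<psi>\<close> for the cutoff. In each coordinate direction \<open>e\<close> the function
  \<open>\<phi>'(u) u\<^sub>e \<psi> - \<phi>(u) \<psi>\<^sub>e\<close> has compact support, so its derivative along \<open>e\<close> has integral \<open>0\<close>. In that
  derivative the two terms \<open>\<phi>'(u) u\<^sub>e \<psi>\<^sub>e\<close> cancel, and summing over \<open>e\<close> turns the pure second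
  derivatives of \<open>u\<close> into the time derivative by the heat equation.
\<close>
lemma spatial_identity:
  assumes t: "0 < t" and R: "1 \<le> R"
  shows "(\<integral>x. \<phi>' (u t x) * ut t x * cutoff R x \<partial>lborel) =
    (\<integral>x. \<phi> (u t x) * (\<Sum>e\<in>Basis. cutoff_dxx e R x) \<partial>lborel)
    - (\<integral>x. \<phi>'' (u t x) * grad2 t x * cutoff R x \<partial>lborel)"
proof -
  let ?F' = "\<lambda>e x. \<phi>'' (u t x) * (ux e t x)\<^sup>2 * cutoff R x + \<phi>' (u t x) * uxx e t x * cutoff R x
    - \<phi> (u t x) * cutoff_dxx e R x"
  note cs = continuous_on_slice[OF weighted_continuous(1) t] continuous_on_slice[OF weighted_continuous(2) t]
    continuous_on_slice[OF weighted_continuous(3) t] continuous_on_slice[OF weighted_continuous(4) t]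
    continuous_on_slice[OF weighted_continuous(5) t] continuous_on_slice[OF weighted_continuous(6) t]
  have cF': "continuous_on UNIV (?F' e)" for e
    by (intro continuous_intros cs cutoff_continuous phi_continuous phi''_continuous)
  have sF': "?F' e x = 0" if "R < norm x" for e x
    using cutoff_support[OF R that] by simp
  have int: "integrable lborel (?F' e)" for e
    by (rule integrable_continuous_bounded_support[OF cF' sF'])
  have "(\<integral>x. ?F' e x \<partial>lborel) = 0" for e
  proof (rule integral_directional_derivative_eq_0[OF _ _ cF' _ sF'])
    let ?F = "\<lambda>x. \<phi>' (u t x) * ux e t x * cutoff R x - \<phi> (u t x) * cutoff_dx e R x"
    show "continuous_on UNIV ?F"
      by (intro continuous_intros cs cutoff_continuous phi_continuous)
    show "?F x = 0" if "R < norm x" for x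
      using cutoff_support[OF R that] by simp
    fix x
    have u: "((\<lambda>s. u t (x + s *\<^sub>R e)) has_real_derivative ux e t x) (at 0)"
      by (rule has_derivative_line[OF heat_conv_derivs(1)[OF f t]])
    have ux: "((\<lambda>s. ux e t (x + s *\<^sub>R e)) has_real_derivative uxx e t x) (at 0)"
      by (rule has_derivative_line[OF heat_conv_derivs(2)[OF f t]])
    have p: "((\<lambda>s. \<phi> (u t (x + s *\<^sub>R e))) has_real_derivative \<phi>' (u t (x + 0 *\<^sub>R e)) * ux e t x) (at 0)"
      by (rule DERIV_chain2[OF phi_deriv u])
    have p': "((\<lambda>s. \<phi>' (u t (x + s *\<^sub>R e))) has_real_derivative \<phi>'' (u t (x + 0 *\<^sub>R e)) * ux e t x) (at 0)"
      by (rule DERIV_chain2[OF phi'_deriv u])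
    from DERIV_diff[OF DERIV_mult[OF DERIV_mult[OF p' ux] cutoff_line_deriv[of R x e]]
        DERIV_mult[OF p cutoff_dx_line_deriv[of e R x]]]
    show "((\<lambda>s. ?F (x + s *\<^sub>R e)) has_real_derivative ?F' e x) (at 0)"
      by (rule DERIV_cong) (simp add: algebra_simps power2_eq_square)
  qed
  then have "0 = (\<Sum>e\<in>Basis. \<integral>x. ?F' e x \<partial>lborel)" by simp
  also have "\<dots> = (\<integral>x. (\<Sum>e\<in>Basis. ?F' e x) \<partial>lborel)"
    using int by (intro Bochner_Integration.integral_sum[symmetric]) auto
  also have "(\<lambda>x. \<Sum>e\<in>Basis. ?F' e x) = (\<lambda>x. \<phi>'' (u t x) * grad2 t x * cutoff R x + \<phi>' (u t x) * ut t x * cutoff R x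
      - \<phi> (u t x) * (\<Sum>e\<in>Basis. cutoff_dxx e R x))"
    by (simp add: heat_equation[OF f t] sum.distrib sum_subtractf sum_distrib_left sum_distrib_right)
  also have "(\<integral>x. \<phi>'' (u t x) * grad2 t x * cutoff R x + \<phi>' (u t x) * ut t x * cutoff R x
      - \<phi> (u t x) * (\<Sum>e\<in>Basis. cutoff_dxx e R x) \<partial>lborel)
    = (\<integral>x. \<phi>'' (u t x) * grad2 t x * cutoff R x \<partial>lborel) + (\<integral>x. \<phi>' (u t x) * ut t x * cutoff R x \<partial>lborel)
      - (\<integral>x. \<phi> (u t x) * (\<Sum>e\<in>Basis. cutoff_dxx e R x) \<partial>lborel)"
  proof -
    have "integrable lborel (\<lambda>x. \<phi>'' (u t x) * grad2 t x * cutoff R x)"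
      "integrable lborel (\<lambda>x. \<phi>' (u t x) * ut t x * cutoff R x)"
      "integrable lborel (\<lambda>x. \<phi> (u t x) * (\<Sum>e\<in>Basis. cutoff_dxx e R x))"
      by (rule integrable_continuous_bounded_support[where R = R],
          intro continuous_intros cs cutoff_continuous phi_continuous phi''_continuous, simp add: cutoff_support[OF R])+
    then show ?thesis by simp
  qed
  finally show ?thesis by simp
qed

lemma energy_deriv:
  assumes t: "0 < t" and R: "1 \<le> R"
  shows "((\<lambda>t. \<integral>x. \<phi> (u t x) * cutoff R x \<partial>lborel) has_real_derivative
    (\<integral>x. \<phi>' (u t x) * ut t x * cutoff R x \<partial>lborel)) (at t)"
proof -
  obtain C where C: "\<And>s x. s \<in> {t/2..2*t} \<Longrightarrow> \<bar>\<phi>' (u s x) * ut s x * cutoff R x\<bar> \<le> C * indicator (cball 0 R) x"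
    using local_bound_compact_support[OF weighted_continuous(2)[OF cutoff_continuous(1) phi_continuous(2)], of R R "t/2" "2*t"]
      t cutoff_support(1)[OF R] by auto
  show ?thesis
  proof (rule DERIV_integral_dominated[OF _ _ integrable_const_indicator_cball[of C R], where r = "t/2"])
    fix s assume "s \<in> ball t (t/2)"
    then have s: "0 < s" "s \<in> {t/2..2*t}" using t unfolding mem_ball dist_real_def atLeastAtMost_iff by linarith+
    show "integrable lborel (\<lambda>x. \<phi> (u s x) * cutoff R x)"
      by (rule integrable_continuous_bounded_support[where R = R])
        (auto intro: continuous_on_slice[OF weighted_continuous(1) s(1)] cutoff_continuous phi_continuous simp: cutoff_support[OF R])
    fix x
    show "\<bar>\<phi>' (u s x) * ut s x * cutoff R x\<bar> \<le> C * indicator (cball 0 R) x" by (rule C[OF s(2)])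
    have "((\<lambda>t. \<phi> (u t x)) has_real_derivative \<phi>' (u s x) * ut s x) (at s)"
      by (rule DERIV_chain2[OF phi_deriv heat_conv_has_derivative_t[OF f s(1)]])
    then show "((\<lambda>t. \<phi> (u t x) * cutoff R x) has_real_derivative \<phi>' (u s x) * ut s x * cutoff R x) (at s)"
      by (rule DERIV_cmult_right)
  qed (use t in auto)
qed

text \<open>
  Integrate the time derivative of the localized energy, rewritten by \<open>spatial_identity\<close>, from \<open>a\<close> to \<open>b\<close>.
  The number \<open>\<epsilon>\<close> is the contribution of the Laplacian of the cutoff.
\<close>
lemma localized_energy_identity:
  assumes ab: "0 < a" "a \<le> b" and R: "1 \<le> R" and nn: "\<And>u. 0 \<le> \<phi>'' u"
    and M: "\<And>t. 0 < t \<Longrightarrow> (\<integral>\<^sup>+x. ennreal \<bar>\<phi> (u t x)\<bar> \<partial>lborel) \<le> ennreal M" "0 \<le> M"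
  obtains \<epsilon> where
    "(\<integral>\<^sup>+t. (\<integral>\<^sup>+x. ennreal (\<phi>'' (u t x) * grad2 t x * cutoff R x) \<partial>lborel) * indicator {a..b} t \<partial>lborel) =
      ennreal ((\<integral>x. \<phi> (u a x) * cutoff R x \<partial>lborel) - (\<integral>x. \<phi> (u b x) * cutoff R x \<partial>lborel) + \<epsilon>)"
    "\<bar>\<epsilon>\<bar> \<le> (24 + 6 * DIM('a)) / R * M * (b - a)"
proof -
  let ?W = "\<lambda>t. \<integral>x. \<phi> (u t x) * cutoff R x \<partial>lborel"
  let ?J = "\<lambda>t. \<integral>x. \<phi>'' (u t x) * grad2 t x * cutoff R x \<partial>lborel"
  let ?E = "\<lambda>t. \<integral>x. \<phi> (u t x) * (\<Sum>e\<in>Basis. cutoff_dxx e R x) \<partial>lborel"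
  define K where "K = (24 + 6 * DIM('a)) / R"
  have K: "0 \<le> K" using R by (simp add: K_def)
  have pos: "0 < t" if "t \<in> {a..b}" for t using that ab by auto
  have lap: "continuous_on UNIV (\<lambda>x::'a. \<Sum>e\<in>Basis. cutoff_dxx e R x)"
    by (intro continuous_intros cutoff_continuous)
  have "(?W has_vector_derivative (?E t - ?J t)) (at t within {a..b})" if "t \<in> {a..b}" for t
    using energy_deriv[OF pos[OF that] R] spatial_identity[OF pos[OF that] R]
    by (auto simp: has_real_derivative_iff_has_vector_derivative[symmetric] intro: has_field_derivative_at_within)
  then have 1: "((\<lambda>t. ?E t - ?J t) has_integral (?W b - ?W a)) {a..b}"
    by (rule fundamental_theorem_of_calculus[OF ab(2)])
  have cE: "continuous_on {a..b} ?E"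
  proof (intro continuous_at_imp_continuous_on ballI)
    fix t assume "t \<in> {a..b}"
    from pos[OF this] show "isCont ?E t"
      by (intro continuous_compact_support_integral[OF weighted_continuous(1)[OF lap phi_continuous(1)], where R = R])
        (simp_all add: cutoff_support[OF R])
  qed
  then have E: "(?E has_integral integral {a..b} ?E) {a..b}"
    by (intro integrable_integral integrable_continuous_real)
  have J: "(?J has_integral (integral {a..b} ?E - (?W b - ?W a))) {a..b}"
    using has_integral_diff[OF E 1] by simp
  have intJ: "integrable lborel (\<lambda>x. \<phi>'' (u t x) * grad2 t x * cutoff R x)" if "t \<in> {a..b}" for t
    by (rule integrable_continuous_bounded_support[where R = R])
      (auto intro: continuous_on_slice[OF weighted_continuous(3) pos[OF that]] cutoff_continuous phi''_continuous simp: cutoff_support[OF R])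
  have nnJ: "0 \<le> \<phi>'' (u t x) * grad2 t x * cutoff R x" for t x
    using nn cutoff_bounds(1)[of R x] R by (intro mult_nonneg_nonneg sum_nonneg) auto
  have "(\<integral>\<^sup>+t. (\<integral>\<^sup>+x. ennreal (\<phi>'' (u t x) * grad2 t x * cutoff R x) \<partial>lborel) * indicator {a..b} t \<partial>lborel)
     = (\<integral>\<^sup>+t. ennreal (?J t) * indicator {a..b} t \<partial>lborel)"
    using nnJ by (intro nn_integral_cong) (auto simp: indicator_def nn_integral_eq_integral[OF intJ])
  also have "\<dots> = ennreal (integral {a..b} ?E - (?W b - ?W a))"
    using nnJ J by (intro nn_integral_has_integral_lebesgue' integral_nonneg_AE) auto
  finally have "(\<integral>\<^sup>+t. (\<integral>\<^sup>+x. ennreal (\<phi>'' (u t x) * grad2 t x * cutoff R x) \<partial>lborel) * indicator {a..b} t \<partial>lborel)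
     = ennreal (?W a - ?W b + integral {a..b} ?E)" by (simp add: algebra_simps)
  moreover have "\<bar>integral {a..b} ?E\<bar> \<le> K * M * (b - a)"
  proof -
    have "\<bar>?E t\<bar> \<le> K * M" if t: "t \<in> {a..b}" for t
    proof -
      have i: "integrable lborel (\<lambda>x. \<bar>\<phi> (u t x)\<bar>)"
        using M(1)[OF pos[OF t]] by (intro integrableI_nonneg) (auto intro: le_less_trans)
      have "\<bar>?E t\<bar> \<le> (\<integral>x. \<bar>\<phi> (u t x) * (\<Sum>e\<in>Basis. cutoff_dxx e R x)\<bar> \<partial>lborel)"
        by (rule integral_abs_bound)
      also have "\<dots> \<le> (\<integral>x. \<bar>\<phi> (u t x)\<bar> * K \<partial>lborel)"
      proof (rule integral_mono)
        show "integrable lborel (\<lambda>x. \<bar>\<phi> (u t x) * (\<Sum>e\<in>Basis. cutoff_dxx e R x)\<bar>)"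
          by (intro integrable_abs integrable_continuous_bounded_support[where R = R]
              continuous_on_slice[OF weighted_continuous(1) pos[OF t]] lap phi_continuous) (simp add: cutoff_support[OF R])
        show "integrable lborel (\<lambda>x. \<bar>\<phi> (u t x)\<bar> * K)" by (intro integrable_mult_left i)
        show "\<bar>\<phi> (u t x) * (\<Sum>e\<in>Basis. cutoff_dxx e R x)\<bar> \<le> \<bar>\<phi> (u t x)\<bar> * K" for x
          unfolding abs_mult K_def using R by (intro mult_left_mono cutoff_laplacian_bound) auto
      qed
      also have "\<dots> = (\<integral>x. \<bar>\<phi> (u t x)\<bar> \<partial>lborel) * K" by simp
      also have "\<dots> \<le> M * K"
      proof (rule mult_right_mono[OF _ K])
        have "ennreal (\<integral>x. \<bar>\<phi> (u t x)\<bar> \<partial>lborel) \<le> ennreal M"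
          using M(1)[OF pos[OF t]] by (subst (asm) nn_integral_eq_integral[OF i]) auto
        then show "(\<integral>x. \<bar>\<phi> (u t x)\<bar> \<partial>lborel) \<le> M" using M(2) by (simp add: ennreal_le_iff)
      qed
      finally show ?thesis by (simp add: mult.commute)
    qed
    then show ?thesis using integral_bound[OF ab(2) cE, of "K * M"] by simp
  qed
  ultimately show thesis using that unfolding K_def by blast
qed

end

section \<open>The identity on a compact time interval\<close>

lemma measurable_epowr [measurable]: "(\<lambda>x. epowr x k) \<in> borel_measurable borel"
  unfolding epowr_def[abs_def] by measurable

text \<open>
  Continuity is available for positive times only, and nothing useful is known of \<open>g\<close> at other times;
  joint measurability is therefore stated for the extension by zero.
\<close>
lemma measurable_of_continuous_halfspace:
  fixes g :: "real \<Rightarrow> 'a::euclidean_space \<Rightarrow> real"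
  assumes "continuous_on ({0<..} \<times> UNIV) (\<lambda>(t, x). g t x)"
  shows "(\<lambda>(t, x). indicator {0<..} t * g t x) \<in> borel_measurable (borel \<Otimes>\<^sub>M borel)"
proof -
  have "(\<lambda>z. indicator ({0<..} \<times> UNIV) z *\<^sub>R (\<lambda>(t, x). g t x) z) \<in> borel_measurable (borel :: (real \<times> 'a) measure)"
    by (rule borel_measurable_continuous_on_indicator[OF _ assms]) (auto intro!: borel_open open_Times)
  moreover have "indicator ({0<..} \<times> UNIV) z *\<^sub>R (\<lambda>(t, x). g t x) z = (\<lambda>(t, x). indicator {0<..} t * g t x) z" for z
    by (auto simp: indicator_def split: prod.splits)
  ultimately show ?thesis unfolding borel_prod by simp
qed

locale heat_Lp =
  fixes f :: "'a::euclidean_space \<Rightarrow> real" and p :: real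
  assumes p: "1 < p" and f_meas [measurable]: "f \<in> borel_measurable borel"
    and fin: "Lp_norm_powr p f < \<infinity>"
begin

lemma f_gauss_integrable: "gauss_integrable f"
  using Lp_gauss_integrable[OF f_meas fin] p by simp

abbreviation "u \<equiv> heat_conv f heat_kernel"
abbreviation "grad2 t x \<equiv> \<Sum>e\<in>Basis. (heat_conv f (heat_kernel_dx e) t x)\<^sup>2"

lemma Lp_u: "0 < t \<Longrightarrow> Lp_norm_powr p (u t) \<le> Lp_norm_powr p f"
  by (rule heat_contraction[OF f_meas fin p])

lemma Lp_u_finite: "0 < t \<Longrightarrow> Lp_norm_powr p (u t) < \<infinity>"
  using Lp_u fin by (rule le_less_trans)

lemma grad2_nonneg: "0 \<le> grad2 t x"
  by (simp add: sum_nonneg)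

lemma jointly_measurable [measurable]:
  "(\<lambda>(t, x). indicator {0<..} t * u t x) \<in> borel_measurable (borel \<Otimes>\<^sub>M borel)"
  "(\<lambda>(t, x). indicator {0<..} t * grad2 t x) \<in> borel_measurable (borel \<Otimes>\<^sub>M borel)"
proof -
  show "(\<lambda>(t, x). indicator {0<..} t * u t x) \<in> borel_measurable (borel \<Otimes>\<^sub>M borel)"
    by (rule measurable_of_continuous_halfspace[OF heat_conv_continuous_kernels(1)[OF f_gauss_integrable]])
  show "(\<lambda>(t, x). indicator {0<..} t * grad2 t x) \<in> borel_measurable (borel \<Otimes>\<^sub>M borel)"
    by (rule measurable_of_continuous_halfspace)
      (use heat_conv_continuous_kernels(3)[OF f_gauss_integrable] in \<open>auto simp: split_def intro!: continuous_on_sum continuous_on_power\<close>)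
qed

abbreviation "energy_density t x \<equiv> epowr \<bar>u t x\<bar> (p - 2) * ennreal (grad2 t x)"

lemma measurable_time_slice:
  fixes F :: "real \<Rightarrow> ennreal" and \<psi> :: "'a \<Rightarrow> real"
  assumes [measurable]: "F \<in> borel_measurable borel" "\<psi> \<in> borel_measurable borel" "T \<in> sets borel"
    and T: "T \<subseteq> {0<..}"
  shows "(\<lambda>t. (\<integral>\<^sup>+x. F (u t x) * ennreal (grad2 t x) * ennreal (\<psi> x) \<partial>lborel) * indicator T t) \<in> borel_measurable borel"
proof -
  have "(\<lambda>t. (\<integral>\<^sup>+x. F (indicator {0<..} t * u t x) * ennreal (indicator {0<..} t * grad2 t x) * ennreal (\<psi> x) \<partial>lborel) * indicator T t)
      \<in> borel_measurable borel"
    by measurable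
  moreover have "(\<integral>\<^sup>+x. F (indicator {0<..} t * u t x) * ennreal (indicator {0<..} t * grad2 t x) * ennreal (\<psi> x) \<partial>lborel) * indicator T t
      = (\<integral>\<^sup>+x. F (u t x) * ennreal (grad2 t x) * ennreal (\<psi> x) \<partial>lborel) * indicator T t" for t
    using T by (auto simp: indicator_def)
  ultimately show ?thesis by simp
qed

lemma density_measurable:
  assumes "T \<in> sets borel" "T \<subseteq> {0<..}"
  shows "(\<lambda>t. (\<integral>\<^sup>+x. energy_density t x \<partial>lborel) * indicator T t) \<in> borel_measurable borel"
  using measurable_time_slice[of "\<lambda>v. epowr \<bar>v\<bar> (p - 2)" "\<lambda>x. 1" T] assms by simp

lemma approx_energy_tendsto:
  assumes t: "0 < t"
  shows "(\<lambda>n. \<integral>x. reg_powr p (reg_eps p n) (u t x) * cutoff (real (Suc n)) x \<partial>lborel) \<longlonglongrightarrow> (\<integral>x. \<bar>u t x\<bar> powr p \<partial>lborel)"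
proof (rule integral_dominated_convergence[where w = "\<lambda>x. \<bar>u t x\<bar> powr p"])
  show "integrable lborel (\<lambda>x. \<bar>u t x\<bar> powr p)"
    by (rule Lp_finite_integrable[OF _ Lp_u_finite[OF t]]) simp
  have [measurable]: "reg_powr p (reg_eps p n) \<in> borel_measurable borel" for n
    by (rule borel_measurable_continuous_onI[OF reg_powr_continuous[OF p reg_eps(1)]])
  have [measurable]: "cutoff R \<in> borel_measurable (borel :: 'a measure)" for R
    by (rule borel_measurable_continuous_onI[OF cutoff_continuous(1)])
  show "(\<lambda>x. reg_powr p (reg_eps p n) (u t x) * cutoff (real (Suc n)) x) \<in> borel_measurable lborel" for n
    by measurable
  show "AE x in lborel. (\<lambda>n. reg_powr p (reg_eps p n) (u t x) * cutoff (real (Suc n)) x) \<longlonglongrightarrow> \<bar>u t x\<bar> powr p"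
    using tendsto_mult[OF reg_powr_tendsto[OF p] cutoff_tendsto] by (intro AE_I2) simp
  show "AE x in lborel. norm (reg_powr p (reg_eps p n) (u t x) * cutoff (real (Suc n)) x) \<le> \<bar>u t x\<bar> powr p" for n
  proof (rule AE_I2)
    fix x
    have "reg_powr p (reg_eps p n) (u t x) * cutoff (real (Suc n)) x \<le> \<bar>u t x\<bar> powr p * 1"
      using reg_powr_bounds[OF p reg_eps(1) reg_eps(3), of n "u t x"] cutoff_bounds[of "real (Suc n)" x]
      by (intro mult_mono) auto
    then show "norm (reg_powr p (reg_eps p n) (u t x) * cutoff (real (Suc n)) x) \<le> \<bar>u t x\<bar> powr p"
      using reg_powr_bounds[OF p reg_eps(1) reg_eps(3), of n "u t x"] cutoff_bounds[of "real (Suc n)" x]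
      by (simp add: abs_mult)
  qed
qed simp

text \<open>
  The limits of large \<open>R\<close> and of vanishing shift \<open>e\<close> are taken along one sequence. On the left the
  integrand increases in \<open>n\<close>, since the second derivative and the cutoff both do, and monotone
  convergence applies even where the limit is infinite. On the right \<open>\<bar>u\<bar> powr p\<close> dominates, and the cutoff error is
  of order \<open>1 / n\<close>.
\<close>
lemma energy_identity_interval:
  assumes ab: "0 < a" "a \<le> b"
  shows "ennreal (p * (p - 1)) * (\<integral>\<^sup>+t. (\<integral>\<^sup>+x. energy_density t x \<partial>lborel) * indicator {a..b} t \<partial>lborel) =
    ennreal ((\<integral>x. \<bar>u a x\<bar> powr p \<partial>lborel) - (\<integral>x. \<bar>u b x\<bar> powr p \<partial>lborel))"
proof -
  define e where "e = reg_eps p"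
  let ?R = "\<lambda>n. real (Suc n)"
  let ?D = "\<lambda>n t x. ennreal (reg_powr'' p (e n) (u t x)) * ennreal (grad2 t x) * ennreal (cutoff (?R n) x)"
  let ?I = "\<lambda>n. \<integral>\<^sup>+t. (\<integral>\<^sup>+x. ?D n t x \<partial>lborel) * indicator {a..b} t \<partial>lborel"
  let ?W = "\<lambda>n t. \<integral>x. reg_powr p (e n) (u t x) * cutoff (?R n) x \<partial>lborel"
  let ?A = "\<lambda>t. \<integral>x. \<bar>u t x\<bar> powr p \<partial>lborel"
  define M where "M = enn2real (Lp_norm_powr p f)"
  have M: "Lp_norm_powr p f = ennreal M" "0 \<le> M" using fin by (simp_all add: M_def)
  have ab': "{a..b} \<subseteq> {0<..}" using ab by auto
  note e = reg_eps[of p, folded e_def]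
  have [measurable]: "reg_powr'' p (e n) \<in> borel_measurable borel" for n
    by (rule borel_measurable_continuous_onI[OF reg_powr''_continuous[OF e(1,2)]])
  have [measurable]: "cutoff R \<in> borel_measurable (borel :: 'a measure)" for R
    by (rule borel_measurable_continuous_onI[OF cutoff_continuous(1)])
  have D_mono: "?D m t x \<le> ?D n t x" if "m \<le> n" for m n t x
    unfolding e_def using that
    by (intro mult_mono ennreal_leI reg_powr''_mono p cutoff_mono) auto
  have "\<exists>\<epsilon>. ?I n = ennreal (?W n a - ?W n b + \<epsilon>) \<and> \<bar>\<epsilon>\<bar> \<le> (24 + 6 * DIM('a)) / ?R n * M * (b - a)" for n
  proof -
    interpret E: heat_energy f "reg_powr p (e n)" "reg_powr' p (e n)" "reg_powr'' p (e n)"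
      using f_gauss_integrable reg_powr_deriv[OF p e(1)] reg_powr'_deriv[OF p e(1,2)] reg_powr''_continuous[OF e(1,2)]
      by unfold_locales auto
    have bM: "(\<integral>\<^sup>+x. ennreal \<bar>reg_powr p (e n) (u t x)\<bar> \<partial>lborel) \<le> ennreal M" if t: "0 < t" for t
    proof -
      have "(\<integral>\<^sup>+x. ennreal \<bar>reg_powr p (e n) (u t x)\<bar> \<partial>lborel) \<le> Lp_norm_powr p (u t)"
        unfolding Lp_norm_powr_def using reg_powr_bounds[OF p e(1,3)]
        by (intro nn_integral_mono ennreal_leI) simp
      then show ?thesis using Lp_u[OF t] M by simp
    qed
    have R1: "1 \<le> ?R n" by simp
    from E.localized_energy_identity[OF ab R1 reg_powr''_nonneg[OF p] bM M(2)]
    obtain \<epsilon> where eps: "(\<integral>\<^sup>+t. (\<integral>\<^sup>+x. ennreal (reg_powr'' p (e n) (u t x) * grad2 t x * cutoff (?R n) x) \<partial>lborel) * indicator {a..b} t \<partial>lborel) =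
        ennreal (?W n a - ?W n b + \<epsilon>)" "\<bar>\<epsilon>\<bar> \<le> (24 + 6 * DIM('a)) / ?R n * M * (b - a)"
      by blast
    have "ennreal (reg_powr'' p (e n) (u t x) * grad2 t x * cutoff (?R n) x) = ?D n t x" for t x
      using reg_powr''_nonneg[OF p] grad2_nonneg cutoff_bounds(1)[of "?R n" x]
      by (simp add: ennreal_mult)
    then show ?thesis using eps by (intro exI[of _ \<epsilon>]) simp
  qed
  then have "\<exists>\<epsilon>. \<forall>n. ?I n = ennreal (?W n a - ?W n b + \<epsilon> n) \<and> \<bar>\<epsilon> n\<bar> \<le> (24 + 6 * DIM('a)) / ?R n * M * (b - a)"
    by (intro choice allI)
  then obtain \<epsilon> where eps: "\<And>n. ?I n = ennreal (?W n a - ?W n b + \<epsilon> n)"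
    "\<And>n. \<bar>\<epsilon> n\<bar> \<le> (24 + 6 * DIM('a)) / ?R n * M * (b - a)"
    by blast
  have "\<epsilon> \<longlonglongrightarrow> 0"
  proof (rule Lim_null_comparison)
    show "\<forall>\<^sub>F n in sequentially. norm (\<epsilon> n) \<le> (24 + 6 * DIM('a)) * M * (b - a) * inverse (?R n)"
      using eps(2) by (intro always_eventually allI) (simp add: divide_inverse mult_ac)
    show "(\<lambda>n. (24 + 6 * DIM('a)) * M * (b - a) * inverse (?R n)) \<longlonglongrightarrow> 0"
      by (intro tendsto_mult_right_zero LIMSEQ_inverse_real_of_nat)
  qed
  then have "(\<lambda>n. ?W n a - ?W n b + \<epsilon> n) \<longlonglongrightarrow> ?A a - ?A b + 0"
    unfolding e_def using ab by (intro tendsto_add tendsto_diff approx_energy_tendsto) auto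
  then have lim1: "?I \<longlonglongrightarrow> ennreal (?A a - ?A b)"
    unfolding eps(1) using tendsto_ennrealI by fastforce
  have inner: "(\<lambda>n. \<integral>\<^sup>+x. ?D n t x \<partial>lborel) \<longlonglongrightarrow> (\<integral>\<^sup>+x. ennreal (p * (p - 1)) * energy_density t x \<partial>lborel)" for t
  proof (rule nn_integral_LIMSEQ)
    show "incseq (\<lambda>n x. ?D n t x)" by (intro incseq_SucI le_funI D_mono le_SucI order_refl)
    show "(\<lambda>x. ?D n t x) \<in> borel_measurable lborel" for n by measurable
    fix x
    have "(\<lambda>n. ennreal (reg_powr'' p (e n) (u t x)) * ennreal (cutoff (?R n) x)) \<longlonglongrightarrow>
        ennreal (p * (p - 1)) * epowr \<bar>u t x\<bar> (p - 2) * ennreal 1"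
      unfolding e_def
      by (intro tendsto_mult_ennreal reg_powr''_tendsto p tendsto_ennrealI cutoff_tendsto) auto
    then have "(\<lambda>n. ennreal (grad2 t x) * (ennreal (reg_powr'' p (e n) (u t x)) * ennreal (cutoff (?R n) x))) \<longlonglongrightarrow>
        ennreal (grad2 t x) * (ennreal (p * (p - 1)) * epowr \<bar>u t x\<bar> (p - 2) * ennreal 1)"
      by (intro ennreal_tendsto_cmult) auto
    then show "(\<lambda>n. ?D n t x) \<longlonglongrightarrow> ennreal (p * (p - 1)) * energy_density t x"
      by (simp add: mult_ac)
  qed
  have "?I \<longlonglongrightarrow> (\<integral>\<^sup>+t. (\<integral>\<^sup>+x. ennreal (p * (p - 1)) * energy_density t x \<partial>lborel) * indicator {a..b} t \<partial>lborel)"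
  proof (rule nn_integral_LIMSEQ)
    show "incseq (\<lambda>n t. (\<integral>\<^sup>+x. ?D n t x \<partial>lborel) * indicator {a..b} t)"
      by (intro incseq_SucI le_funI mult_right_mono nn_integral_mono D_mono le_SucI order_refl zero_le)
    show "(\<lambda>t. (\<integral>\<^sup>+x. ?D n t x \<partial>lborel) * indicator {a..b} t) \<in> borel_measurable lborel" for n
      using measurable_time_slice[of "\<lambda>v. ennreal (reg_powr'' p (e n) v)" "cutoff (?R n)" "{a..b}"] ab' by simp
    fix t
    show "(\<lambda>n. (\<integral>\<^sup>+x. ?D n t x \<partial>lborel) * indicator {a..b} t) \<longlonglongrightarrow>
        (\<integral>\<^sup>+x. ennreal (p * (p - 1)) * energy_density t x \<partial>lborel) * indicator {a..b} t"
      using inner[of t] by (cases "t \<in> {a..b}") auto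
  qed
  from LIMSEQ_unique[OF this lim1]
  have "(\<integral>\<^sup>+t. (\<integral>\<^sup>+x. ennreal (p * (p - 1)) * energy_density t x \<partial>lborel) * indicator {a..b} t \<partial>lborel) = ennreal (?A a - ?A b)" .
  also have "(\<integral>\<^sup>+t. (\<integral>\<^sup>+x. ennreal (p * (p - 1)) * energy_density t x \<partial>lborel) * indicator {a..b} t \<partial>lborel)
      = (\<integral>\<^sup>+t. ennreal (p * (p - 1)) * ((\<integral>\<^sup>+x. energy_density t x \<partial>lborel) * indicator {a..b} t) \<partial>lborel)"
    by (intro nn_integral_cong) (simp add: nn_integral_cmult mult.assoc)
  also have "\<dots> = ennreal (p * (p - 1)) * (\<integral>\<^sup>+t. (\<integral>\<^sup>+x. energy_density t x \<partial>lborel) * indicator {a..b} t \<partial>lborel)"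
    using density_measurable[OF _ ab'] by (intro nn_integral_cmult) auto
  finally show ?thesis .
qed

section \<open>The full time axis\<close>

text \<open>
  Increasing the time interval to the half line gives \<open>\<ge>\<close>, because the energy at the left end is at most the
  initial one by contraction. For \<open>\<le>\<close>, the identity from \<open>t\<close> to a late time \<open>b\<close>, at which the energy is
  negligible, bounds the energy at every \<open>t > 0\<close> by the double integral; lower semicontinuity at time \<open>0\<close>
  extends the bound to \<open>f\<close>.
\<close>
lemma energy_identity:
  "Lp_norm_powr p f = ennreal (p * (p - 1)) * (\<integral>\<^sup>+t. (\<integral>\<^sup>+x. energy_density t x \<partial>lborel) * indicator {0<..} t \<partial>lborel)"
  (is "_ = ?c * ?I")
proof (rule antisym)
  let ?A = "\<lambda>t. \<integral>x. \<bar>u t x\<bar> powr p \<partial>lborel"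
  let ?J = "\<lambda>a b. \<integral>\<^sup>+t. (\<integral>\<^sup>+x. energy_density t x \<partial>lborel) * indicator {a..b} t \<partial>lborel"
  have A: "Lp_norm_powr p (u t) = ennreal (?A t)" "0 \<le> ?A t" if "0 < t" for t
    unfolding Lp_norm_powr_def
    by (auto intro!: nn_integral_eq_integral Lp_finite_integrable Lp_u_finite that)
  define T where "T n = {inverse (real (Suc n))..real (Suc n)}" for n
  have T_mono: "T n \<subseteq> T (Suc n)" for n
  proof -
    have "inverse (real (Suc (Suc n))) \<le> inverse (real (Suc n))" by (intro le_imp_inverse_le) auto
    then show ?thesis unfolding T_def by (intro atLeastatMost_subset_iff[THEN iffD2] disjI2) auto
  qed
  have T_pos: "T n \<subseteq> {0<..}" for n
    unfolding T_def using positive_imp_inverse_positive[of "real (Suc n)"]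
    by (auto simp del: of_nat_Suc intro: less_le_trans[of 0 "inverse (real (Suc n))"])
  have T_ev: "\<forall>\<^sub>F n in sequentially. t \<in> T n" if "0 < t" for t
  proof -
    have "\<forall>\<^sub>F n in sequentially. inverse (real (Suc n)) < t"
      using that by (intro order_tendstoD[OF LIMSEQ_inverse_real_of_nat]) auto
    moreover have "\<forall>\<^sub>F n in sequentially. t \<le> real (Suc n)"
    proof -
      obtain N where "t \<le> real N" using real_arch_simple by blast
      then show ?thesis by (intro eventually_sequentiallyI[of N]) auto
    qed
    ultimately show ?thesis
      by eventually_elim (simp add: T_def)
  qed
  have "(\<lambda>n. \<integral>\<^sup>+t. (\<integral>\<^sup>+x. energy_density t x \<partial>lborel) * indicator (T n) t \<partial>lborel) \<longlonglongrightarrow> ?I"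
  proof (rule nn_integral_LIMSEQ)
    show "incseq (\<lambda>n t. (\<integral>\<^sup>+x. energy_density t x \<partial>lborel) * indicator (T n) t)"
      using T_mono by (intro incseq_SucI le_funI mult_left_mono) (auto simp: indicator_def)
    show "(\<lambda>t. (\<integral>\<^sup>+x. energy_density t x \<partial>lborel) * indicator (T n) t) \<in> borel_measurable lborel" for n
      using density_measurable[OF _ T_pos] by (simp add: T_def)
    fix t :: real
    show "(\<lambda>n. (\<integral>\<^sup>+x. energy_density t x \<partial>lborel) * indicator (T n) t) \<longlonglongrightarrow>
        (\<integral>\<^sup>+x. energy_density t x \<partial>lborel) * indicator {0<..} t"
    proof (cases "0 < t")
      case True
      have "\<forall>\<^sub>F n in sequentially. (\<integral>\<^sup>+x. energy_density t x \<partial>lborel) * indicator (T n) t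
          = (\<integral>\<^sup>+x. energy_density t x \<partial>lborel) * indicator {0<..} t"
        using T_ev[OF True] by eventually_elim (use True in simp)
      then show ?thesis by (rule tendsto_eventually)
    next
      case False
      then have "t \<notin> T n" for n using T_pos[of n] by auto
      then show ?thesis using False by simp
    qed
  qed
  then have "(\<lambda>n. ?J (inverse (real (Suc n))) (real (Suc n))) \<longlonglongrightarrow> ?I"
    unfolding T_def .
  then have "(\<lambda>n. ?c * ?J (inverse (real (Suc n))) (real (Suc n))) \<longlonglongrightarrow> ?c * ?I"
    by (intro ennreal_tendsto_cmult) auto
  then show I_le: "?c * ?I \<le> Lp_norm_powr p f"
  proof (rule LIMSEQ_le_const2)
    have "?c * ?J (inverse (real (Suc n))) (real (Suc n)) \<le> Lp_norm_powr p f" for n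
    proof -
      have pos: "0 < inverse (real (Suc n))" by simp
      have "inverse (real (Suc n)) \<le> real (Suc n)"
        by (rule order_trans[of _ 1]) (auto simp: inverse_le_1_iff)
      from energy_identity_interval[OF pos this]
      have "?c * ?J (inverse (real (Suc n))) (real (Suc n)) \<le> ennreal (?A (inverse (real (Suc n))))"
        by (simp add: ennreal_leI del: of_nat_Suc)
      also have "\<dots> = Lp_norm_powr p (u (inverse (real (Suc n))))" using A(1)[OF pos] by simp
      also have "\<dots> \<le> Lp_norm_powr p f" by (rule Lp_u[OF pos])
      finally show ?thesis .
    qed
    then show "\<exists>N. \<forall>n\<ge>N. ?c * ?J (inverse (real (Suc n))) (real (Suc n)) \<le> Lp_norm_powr p f" by blast
  qed
  define S where "S = enn2real (?c * ?I)"
  have S: "?c * ?I = ennreal S" "0 \<le> S"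
    using le_less_trans[OF I_le fin] by (simp_all add: S_def)
  have "Lp_norm_powr p f \<le> ennreal S"
  proof (rule heat_conv_initial_lower[OF f_meas fin p _ S(2)])
    fix t :: real assume t: "0 < t"
    show "Lp_norm_powr p (u t) \<le> ennreal S"
    proof (rule ennreal_le_epsilon)
      fix e :: real assume e: "0 < e"
      have "\<forall>\<^sub>F b in at_top. Lp_norm_powr p (u b) < ennreal e \<and> t \<le> b"
        using heat_conv_decay[OF f_meas fin p e] eventually_ge_at_top[of t] by (rule eventually_conj)
      then obtain b where b: "Lp_norm_powr p (u b) < ennreal e" "t \<le> b"
        by (auto simp: eventually_at_top_linorder)
      have "ennreal (?A t) \<le> ennreal (?A t - ?A b) + ennreal (?A b)"
        using A(2)[of t] A(2)[of b] t b(2)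
        by (cases "?A b \<le> ?A t") (auto simp: ennreal_plus[symmetric] ennreal_leI intro: add_increasing simp del: ennreal_plus)
      also have "ennreal (?A t - ?A b) = ?c * ?J t b" using energy_identity_interval[OF t b(2)] by simp
      also have "\<dots> \<le> ?c * ?I"
        using t by (intro mult_left_mono nn_integral_mono) (auto simp: indicator_def)
      also have "ennreal (?A b) \<le> ennreal e"
        using b A(1)[of b] t by simp
      finally show "Lp_norm_powr p (u t) \<le> ennreal S + ennreal e"
        using A(1)[OF t] S by (simp add: add_left_mono)
    qed
  qed
  then show "Lp_norm_powr p f \<le> ?c * ?I" using S by simp
qed

end

theorem mainTheorem3:
  fixes f :: "'a::euclidean_space \<Rightarrow> real" and p :: real
  assumes "1 < p" and "f \<in> Lp p"
  shows "(\<integral>\<^sup>+ x. ennreal (\<bar>f x\<bar> powr p) \<partial>lebesgue) =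
    ennreal (p * (p - 1)) *
      (\<integral>\<^sup>+ t\<in>{0<..}.
        (\<integral>\<^sup>+ x. epowr \<bar>gauss_semigroup t f x\<bar> (p - 2)
            * ennreal ((norm (gradient (gauss_semigroup t f) x))\<^sup>2) \<partial>lebesgue) \<partial>lebesgue)"
proof -
  have f: "f \<in> borel_measurable lebesgue" "integrable lebesgue (\<lambda>x. \<bar>f x\<bar> powr p)"
    using assms(2) by (auto simp: Lp_def)
  \<comment> \<open>A Borel representative changes neither the left-hand side nor the semigroup, and makes Tonelli applicable.\<close>
  obtain g where g: "g \<in> borel_measurable lborel" "AE x in lborel. f x = g x"
    using completion_ex_borel_measurable_real[OF f(1)] by blast
  have gm: "g \<in> borel_measurable borel" using g(1) by simp
  have ae: "AE x in lebesgue. f x = g x" using g(2) by (rule AE_completion)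
  have gl: "g \<in> borel_measurable lebesgue" using g(1) by (rule measurable_completion)
  have norm: "(\<integral>\<^sup>+ x. ennreal (\<bar>f x\<bar> powr p) \<partial>lebesgue) = Lp_norm_powr p g"
    unfolding Lp_norm_powr_def nn_integral_completion
    using g(2) by (intro nn_integral_cong_AE) auto
  have "(\<integral>\<^sup>+ x. ennreal (\<bar>f x\<bar> powr p) \<partial>lebesgue) < \<infinity>"
    using nn_integral_eq_integral[OF f(2)] by simp
  then interpret heat_Lp g p
    using assms(1) gm norm by unfold_locales auto
  have semi: "gauss_semigroup t f = gauss_semigroup t g" for t
  proof
    fix x :: 'a
    have hk: "(\<lambda>y. heat_kernel t (x - y)) \<in> borel_measurable lebesgue"
      by (rule measurable_completion) simp
    show "gauss_semigroup t f x = gauss_semigroup t g x"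
      unfolding gauss_semigroup_def
      using ae by (intro integral_cong_AE borel_measurable_times f gl hk) auto
  qed
  have "(\<integral>\<^sup>+ x. epowr \<bar>gauss_semigroup t f x\<bar> (p - 2)
            * ennreal ((norm (gradient (gauss_semigroup t f) x))\<^sup>2) \<partial>lebesgue) * indicator {0<..} t
      = (\<integral>\<^sup>+x. energy_density t x \<partial>lborel) * indicator {0<..} t" for t
    by (cases "0 < t")
      (simp_all add: semi nn_integral_completion gauss_semigroup_eq_heat_conv[OF gm]
        norm_gradient_gauss_semigroup[OF f_gauss_integrable, unfolded gauss_semigroup_eq_heat_conv[OF gm]])
  then show ?thesis
    unfolding norm by (simp only: energy_identity nn_integral_completion)
qed

end
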